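(* Let $\mathbb K$ be an algebraically closed field of characteristic zero, and let $F\in \mathbb K_{\mathrm{dp}}[X_0,\dots,X_n]_d$ be a concise form of cactus rank $r>n+1$. Let $\operatorname{Spec}(A)\subset\mathbb P^n$ be a minimal apolar scheme to $F$ (i.e. of length $r$) lying in the chart $x_0\neq 0$, where $A$ is an Artinian Gorenstein algebra with a presentation $A=R/\operatorname{Ann}(\Lambda)$, $R=\mathbb K[x_1,\dots,x_n]$, for some $\Lambda\in R^*$ extending the dehomogenization of $F$. Assume that $B=\{1,x_1,\dots,x_n,b_{n+1},\dots,b_{r-1}\}$ is a monomial basis of $A$. Then the symbolic multiplication matrices $\widetilde M_{x_i}(\lambda)$, $i=1,\dots,n$, constructed from the tensor $\mu^{(d-1)}_{A,s}(\lambda)$, coincide with the symbolic multiplication matrices $M_{x_i}(h)$, $i=1,\dots,n$, constructed via the Hankel operators (both constructions are described in the context), after a canonical bijection between their sets of variables. More precisely, there exists a bijection $$\Psi:H\longrightarrow\Delta$$ between the set $H$ of moment variables $h_\alpha$ appearing in the matrices $M_{x_i}(h)$ and the set $\Delta$ of undetermined coefficients $\lambda_m$ appearing in the matrices $\widetilde M_{x_i}(\lambda)$, such that $$M_{x_i}(\Psi(h))=\widetilde M_{x_i}(\lambda)\qquad\text{for all } i=1,\dots,n.$$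
   Context: Notation. $S=\mathbb K[x_0,\dots,x_n]$, $R=\mathbb K[x_1,\dots,x_n]$, $R^*=\operatorname{Hom}_{\mathbb K}(R,\mathbb K)$. $\mathbb K_{\mathrm{dp}}[X_0,\dots,X_n]=\bigoplus_d\operatorname{Hom}_{\mathbb K}(S_d,\mathbb K)$ is the divided power ring, with basis $X^{(\alpha)}$ dual to the monomials $x^\alpha$. Contraction is $(p\lrcorner\Lambda)(q)=\Lambda(pq)$, and $\operatorname{Ann}(\Lambda)=\{p: p\lrcorner\Lambda=0\}$. A zero-dimensional scheme $Z\subset\mathbb P^n$ is apolar to $F$ if $I(Z)\subseteq\operatorname{Ann}(F)$; the cactus rank of $F$ is the minimal length of a scheme apolar to $F$. $F$ is concise if it cannot be written in fewer variables after a linear change of coordinates. An Artinian algebra $A$ is Gorenstein if $A^*$ is generated by a single element as an $A$-module. That $\Lambda$ extends the dehomogenization of $F=\sum_{|\beta|=d}f_\beta X^{(\beta)}$ means $\Lambda(x^\alpha)=f_{(d-|\alpha|,\alpha_1,\dots,\alpha_n)}$ for all $\alpha\in\mathbb N^n$ with $|\alpha|\le d$. Hankel construction. Parametrize $\Lambda$ by setting $\Lambda(x^\alpha)=f_{(d-|\alpha|,\alpha_1,\dots,\alpha_n)}$ if $|\alpha|\le d$ and $\Lambda(x^\alpha)=h_\alpha$, a variable (moment variable), if $|\alpha|>d$. Let $H^B_\Lambda=(\Lambda(bb'))_{b,b'\in B}$ and $H^B_{x_i\lrcorner\Lambda}=(\Lambda(x_ibb'))_{b,b'\in B}$ be the Hankel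 matrices restricted to $\langle B\rangle$. The symbolic matrices $M_{x_i}(h)$ are obtained from the identity $H^B_{x_i\lrcorner\Lambda}=M_{x_i}(h)^t\,H^B_\Lambda$. Tensor construction. The $(d-1)$-th symmetric iterated multiplication tensor of $A$ is the symmetric $d$-linear form $\mu^{(d-1)}_{A,s}(a_1,\dots,a_d)=\Lambda(a_1\cdots a_d)$ on $A$. Using the basis dual to $B$ and identifying $1^*$ with $X_0$, $x_i^*$ with $X_i$ and $b_j^*$ with $X_j$ ($j=n+1,\dots,r-1$), it is a polynomial $\sum_m\lambda_m m\in\mathbb K_{\mathrm{dp}}[X_0,\dots,X_{r-1}]_d$, where $m$ runs over the degree-$d$ divided-power monomials. Each coefficient is $\lambda_m=\Lambda(m')$, where $m'\in R$ is the product of basis elements corresponding to $m$ (so $\lambda_{m_1}=\lambda_{m_2}$ if $m_1'=m_2'$). The coefficients $\lambda_m$ with $\deg m'\le d$ are determined by $F$; the others are not known and are left as variables. The polynomial with these unknown coefficients is denoted $\mu^{(d-1)}_{A,s}(\lambda)$. Writing $1^{d-2}\lrcorner\mu$ and $(1^{d-3}x_i)\lrcorner\mu$ for the bilinear forms obtained from $\mu=\mu^{(d-1)}_{A,s}(\lambda)$ by evaluating $d-2$ arguments at $1,\dots,1$, respectively at $1,\dots,1,x_i$ (with $d-3$ ones), and $M_{1^{d-2}\lrcorner\mu}$, $M_{1^{d-3}x_i\lrcorner\mu}$ for their matrices, one sets $\widetilde M_{x_i}(\lambda)^t=M_{1^{d-3}x_i\lrcorner\mu}\,\bigl(M_{1^{d-2}\lrcorner\mu}\bigr)^{-1}$.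 *)

theory Defs
  imports
    Complex_Main
    "HOL-Library.Poly_Mapping"
    "HOL-Computational_Algebra.Polynomial"
    "HOL-Computational_Algebra.Fraction_Field"
    "HOL-Algebra.QuotRing"
    "Jordan_Normal_Form.Gauss_Jordan_Elimination"
begin

hide_const (open) Polynomial.degree

section \<open>Polynomials in several variables\<close>

type_synonym 'v mon = "'v \<Rightarrow>\<^sub>0 nat"
type_synonym ('v, 'k) mpoly = "'v mon \<Rightarrow>\<^sub>0 'k"

definition mdeg :: "'v mon \<Rightarrow> nat" where
  "mdeg m = (\<Sum>v\<in>Poly_Mapping.keys m. Poly_Mapping.lookup m v)"

definition monomials :: "'v set \<Rightarrow> nat \<Rightarrow> 'v mon set" where
  "monomials V t = {m. Poly_Mapping.keys m \<subseteq> V \<and> mdeg m = t}"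

definition PConst :: "'k \<Rightarrow> ('v, 'k::zero) mpoly" where
  "PConst c = Poly_Mapping.single 0 c"

definition PMon :: "'v mon \<Rightarrow> ('v, 'k::zero_neq_one) mpoly" where
  "PMon m = Poly_Mapping.single m 1"

definition PVar :: "'v \<Rightarrow> ('v, 'k::zero_neq_one) mpoly" where
  "PVar v = PMon (Poly_Mapping.single v 1)"

definition pvars :: "('v, 'k::zero) mpoly \<Rightarrow> 'v set" where
  "pvars p = (\<Union>m\<in>Poly_Mapping.keys p. Poly_Mapping.keys m)"

definition psubst :: "('v \<Rightarrow> ('w, 'k) mpoly) \<Rightarrow> ('v, 'k::comm_ring_1) mpoly \<Rightarrow> ('w, 'k) mpoly" where
  "psubst \<sigma> p = (\<Sum>m\<in>Poly_Mapping.keys p. PConst (Poly_Mapping.lookup p m) *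
     (\<Prod>v\<in>Poly_Mapping.keys m. \<sigma> v ^ Poly_Mapping.lookup m v))"

definition pcomponent :: "nat \<Rightarrow> ('v, 'k::comm_monoid_add) mpoly \<Rightarrow> ('v, 'k) mpoly" where
  "pcomponent t p = (\<Sum>m\<in>{m\<in>Poly_Mapping.keys p. mdeg m = t}.
     Poly_Mapping.single m (Poly_Mapping.lookup p m))"

definition forms :: "'v set \<Rightarrow> nat \<Rightarrow> ('v, 'k::zero) mpoly set" where
  "forms V t = {p. Poly_Mapping.keys p \<subseteq> monomials V t}"

definition poly_ring :: "'v set \<Rightarrow> ('v, 'k::comm_ring_1) mpoly ring" where
  "poly_ring V = \<lparr>carrier = {p. pvars p \<subseteq> V}, mult = (*), one = 1, zero = 0, add = (+)\<rparr>"

interpretation poly_vs: vector_space "\<lambda>(c::'k::field) (p::('v, 'k) mpoly). PConst c * p"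
  by unfold_locales
    (simp_all add: PConst_def algebra_simps mult_single single_add flip: mult.assoc)


section \<open>Dual spaces, contraction and annihilators\<close>

definition poly_dual :: "'v set \<Rightarrow> (('v, 'k::comm_ring_1) mpoly \<Rightarrow> 'k) set" where
  "poly_dual V = {\<Lambda>. (\<forall>p\<in>carrier (poly_ring V). \<forall>q\<in>carrier (poly_ring V). \<Lambda> (p + q) = \<Lambda> p + \<Lambda> q) \<and>
     (\<forall>c. \<forall>p\<in>carrier (poly_ring V). \<Lambda> (PConst c * p) = c * \<Lambda> p)}"

definition contract :: "('v, 'k::comm_ring_1) mpoly \<Rightarrow> (('v, 'k) mpoly \<Rightarrow> 'k) \<Rightarrow> (('v, 'k) mpoly \<Rightarrow> 'k)" where
  "contract p \<Lambda> = (\<lambda>q. \<Lambda> (p * q))"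

definition Ann :: "'v set \<Rightarrow> (('v, 'k::comm_ring_1) mpoly \<Rightarrow> 'k) \<Rightarrow> ('v, 'k) mpoly set" where
  "Ann V \<Lambda> = {p\<in>carrier (poly_ring V). \<forall>q\<in>carrier (poly_ring V). contract p \<Lambda> q = 0}"

text \<open>An element \<open>\<Sum>\<beta>. f\<^sub>\<beta> X\<^sup>(\<^sup>\<beta>\<^sup>)\<close> of the divided power ring is stored as the
  finitely supported family of its coefficients; \<open>dp_fun\<close> is the functional it stands for,
  \<open>X\<^sup>(\<^sup>\<beta>\<^sup>)\<close> being dual to \<open>x\<^sup>\<beta>\<close>.\<close>

definition dp_fun :: "('v, 'k::comm_ring_1) mpoly \<Rightarrow> ('v, 'k) mpoly \<Rightarrow> 'k" where
  "dp_fun F q = (\<Sum>\<beta>\<in>Poly_Mapping.keys F. Poly_Mapping.lookup F \<beta> * Poly_Mapping.lookup q \<beta>)"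

text \<open>An invertible matrix acts on \<open>S\<close> by a linear substitution, and on \<open>Hom(S\<^sub>d, K)\<close> by
  precomposition with it.\<close>

definition coord_change :: "nat \<Rightarrow> nat \<Rightarrow> 'k mat \<Rightarrow> (nat, 'k::field) mpoly \<Rightarrow> (nat, 'k) mpoly" where
  "coord_change n d g F = (\<Sum>\<beta>\<in>monomials {..n} d. Poly_Mapping.single \<beta>
     (dp_fun F (psubst (\<lambda>i. \<Sum>k\<le>n. PConst (g $$ (i, k)) * PVar k) (PMon \<beta>))))"

definition concise :: "nat \<Rightarrow> nat \<Rightarrow> (nat, 'k::field) mpoly \<Rightarrow> bool" where
  "concise n d F \<longleftrightarrow> (\<forall>g\<in>carrier_mat (n + 1) (n + 1). invertible_mat g \<longrightarrow>
     pvars (coord_change n d g F) = {..n})"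


section \<open>Zero-dimensional subschemes of projective space and cactus rank\<close>

text \<open>A closed subscheme of \<open>P\<^sup>n\<close> is given by its saturated homogeneous ideal.\<close>

definition saturated_homogeneous_ideal :: "nat \<Rightarrow> (nat, 'k::field) mpoly set \<Rightarrow> bool" where
  "saturated_homogeneous_ideal n I \<longleftrightarrow> ideal I (poly_ring {..n}) \<and>
     (\<forall>p\<in>I. \<forall>t. pcomponent t p \<in> I) \<and>
     (\<forall>p\<in>carrier (poly_ring {..n}). (\<exists>k. \<forall>q\<in>forms {..n} k. q * p \<in> I) \<longrightarrow> p \<in> I)"

definition hilbert_function :: "nat \<Rightarrow> (nat, 'k::field) mpoly set \<Rightarrow> nat \<Rightarrow> nat" where
  "hilbert_function n I t =
     poly_vs.dim (forms {..n} t :: (nat, 'k) mpoly set) - poly_vs.dim (I \<inter> forms {..n} t)"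

definition zero_dim_scheme :: "nat \<Rightarrow> (nat, 'k::field) mpoly set \<Rightarrow> bool" where
  "zero_dim_scheme n I \<longleftrightarrow> saturated_homogeneous_ideal n I \<and>
     (\<exists>l>0. eventually (\<lambda>t. hilbert_function n I t = l) sequentially)"

definition scheme_length :: "nat \<Rightarrow> (nat, 'k::field) mpoly set \<Rightarrow> nat" where
  "scheme_length n I = (THE l. eventually (\<lambda>t. hilbert_function n I t = l) sequentially)"

definition apolar :: "nat \<Rightarrow> (nat, 'k::field) mpoly set \<Rightarrow> (nat, 'k) mpoly \<Rightarrow> bool" where
  "apolar n I F \<longleftrightarrow> I \<subseteq> Ann {..n} (dp_fun F)"

definition cactus_rank :: "nat \<Rightarrow> (nat, 'k::field) mpoly \<Rightarrow> nat" where
  "cactus_rank n F = (LEAST l. \<exists>I. zero_dim_scheme n I \<and> apolar n I F \<and> scheme_length n I = l)"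

text \<open>The ideal in \<open>S\<close> of \<open>Spec (R/J)\<close>, embedded in \<open>P\<^sup>n\<close> through the chart \<open>x\<^sub>0 \<noteq> 0\<close>.\<close>

definition projective_ideal :: "nat \<Rightarrow> (nat, 'k::field) mpoly set \<Rightarrow> (nat, 'k) mpoly set" where
  "projective_ideal n J = {p\<in>carrier (poly_ring {..n}).
     \<forall>t. psubst (\<lambda>i. if i = 0 then 1 else PVar i) (pcomponent t p) \<in> J}"


section \<open>Artinian Gorenstein algebras\<close>

definition artinian :: "('a, 'b) ring_scheme \<Rightarrow> bool" where
  "artinian A \<longleftrightarrow> (\<forall>I :: nat \<Rightarrow> 'a set. (\<forall>k. ideal (I k) A \<and> I (Suc k) \<subseteq> I k) \<longrightarrow>
     (\<exists>k. \<forall>m\<ge>k. I m = I k))"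

definition quotient_dual :: "'v set \<Rightarrow> ('v, 'k::comm_ring_1) mpoly set \<Rightarrow> (('v, 'k) mpoly set \<Rightarrow> 'k) set" where
  "quotient_dual V J = (let A = poly_ring V Quot J in
     {\<phi>. (\<forall>x\<in>carrier A. \<forall>y\<in>carrier A. \<phi> (x \<oplus>\<^bsub>A\<^esub> y) = \<phi> x + \<phi> y) \<and>
         (\<forall>c. \<forall>x\<in>carrier A. \<phi> ((J +>\<^bsub>poly_ring V\<^esub> PConst c) \<otimes>\<^bsub>A\<^esub> x) = c * \<phi> x)})"

definition artinian_gorenstein :: "'v set \<Rightarrow> ('v, 'k::comm_ring_1) mpoly set \<Rightarrow> bool" where
  "artinian_gorenstein V J \<longleftrightarrow> (let A = poly_ring V Quot J in artinian A \<and>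
     (\<exists>\<phi>\<in>quotient_dual V J. \<forall>\<theta>\<in>quotient_dual V J. \<exists>a\<in>carrier A.
        \<forall>x\<in>carrier A. \<theta> x = \<phi> (a \<otimes>\<^bsub>A\<^esub> x)))"

definition monomial_basis :: "'v set \<Rightarrow> ('v, 'k::comm_ring_1) mpoly set \<Rightarrow> nat \<Rightarrow> (nat \<Rightarrow> 'v mon) \<Rightarrow> bool" where
  "monomial_basis V J r b \<longleftrightarrow> (\<forall>j<r. Poly_Mapping.keys (b j) \<subseteq> V) \<and>
     (\<forall>p\<in>carrier (poly_ring V). \<exists>c. p - (\<Sum>j<r. PConst (c j) * PMon (b j)) \<in> J) \<and>
     (\<forall>c. (\<Sum>j<r. PConst (c j) * PMon (b j)) \<in> J \<longrightarrow> (\<forall>j<r. c j = 0))"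

definition extends_dehom :: "nat \<Rightarrow> nat \<Rightarrow> (nat, 'k::comm_ring_1) mpoly \<Rightarrow> ((nat, 'k) mpoly \<Rightarrow> 'k) \<Rightarrow> bool" where
  "extends_dehom n d F \<Lambda> \<longleftrightarrow> (\<forall>\<alpha>. Poly_Mapping.keys \<alpha> \<subseteq> {1..n} \<and> mdeg \<alpha> \<le> d \<longrightarrow>
     \<Lambda> (PMon \<alpha>) = Poly_Mapping.lookup F (Poly_Mapping.single 0 (d - mdeg \<alpha>) + \<alpha>))"


section \<open>Rational functions\<close>

type_synonym ('v, 'k) ratfun = "('v, 'k) mpoly fract"

definition RConst :: "'k \<Rightarrow> ('v::linorder, 'k::field) ratfun" where
  "RConst c = Fract (PConst c) 1"

definition RVar :: "'v \<Rightarrow> ('v::linorder, 'k::field) ratfun" where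
  "RVar v = Fract (PVar v) 1"

definition rvars :: "('v::linorder, 'k::field) ratfun \<Rightarrow> 'v set" where
  "rvars q = {v. \<nexists>a b. b \<noteq> 0 \<and> v \<notin> pvars a \<and> v \<notin> pvars b \<and> q = Fract a b}"

definition mat_rvars :: "('v::linorder, 'k::field) ratfun mat \<Rightarrow> 'v set" where
  "mat_rvars M = (\<Union>q\<in>elements_mat M. rvars q)"

text \<open>Renaming of variables; it is determined by any representation whose denominator
  does not become zero.\<close>

definition rrename :: "('v \<Rightarrow> 'w) \<Rightarrow> ('v::linorder, 'k::field) ratfun \<Rightarrow> ('w::linorder, 'k) ratfun" where
  "rrename \<psi> q = (THE q'. \<exists>a b. q = Fract a b \<and> psubst (\<lambda>v. PVar (\<psi> v)) b \<noteq> 0 \<and>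
     q' = Fract (psubst (\<lambda>v. PVar (\<psi> v)) a) (psubst (\<lambda>v. PVar (\<psi> v)) b))"


section \<open>The Hankel construction\<close>

text \<open>The moment variable \<open>h\<^sub>\<alpha>\<close> is the variable with index \<open>\<alpha>\<close>.\<close>

definition moment :: "nat \<Rightarrow> (nat, 'k::field) mpoly \<Rightarrow> nat mon \<Rightarrow> (nat mon, 'k) ratfun" where
  "moment d F \<alpha> = (if mdeg \<alpha> \<le> d
     then RConst (Poly_Mapping.lookup F (Poly_Mapping.single 0 (d - mdeg \<alpha>) + \<alpha>)) else RVar \<alpha>)"

definition hankel :: "nat \<Rightarrow> (nat, 'k::field) mpoly \<Rightarrow> nat \<Rightarrow> (nat \<Rightarrow> nat mon) \<Rightarrow> (nat mon, 'k) ratfun mat" where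
  "hankel d F r b = mat r r (\<lambda>(j, k). moment d F (b j + b k))"

definition hankel_shift ::
  "nat \<Rightarrow> (nat, 'k::field) mpoly \<Rightarrow> nat \<Rightarrow> (nat \<Rightarrow> nat mon) \<Rightarrow> nat \<Rightarrow> (nat mon, 'k) ratfun mat" where
  "hankel_shift d F r b i = mat r r (\<lambda>(j, k). moment d F (Poly_Mapping.single i 1 + b j + b k))"

definition hankel_mult ::
  "nat \<Rightarrow> (nat, 'k::field) mpoly \<Rightarrow> nat \<Rightarrow> (nat \<Rightarrow> nat mon) \<Rightarrow> nat \<Rightarrow> (nat mon, 'k) ratfun mat" where
  "hankel_mult d F r b i = (THE M. M \<in> carrier_mat r r \<and>
     hankel_shift d F r b i = transpose_mat M * hankel d F r b)"


section \<open>The tensor construction\<close>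

text \<open>For an exponent \<open>m\<close> of a monomial in \<open>X\<^sub>0, \<dots>, X\<^sub>r\<^sub>-\<^sub>1\<close>, the exponent of the monomial
  \<open>m' \<in> R\<close> obtained by replacing each \<open>X\<^sub>j\<close> by the basis element \<open>b j\<close>.\<close>

definition basis_prod :: "(nat \<Rightarrow> nat mon) \<Rightarrow> nat mon \<Rightarrow> nat mon" where
  "basis_prod b m = (\<Sum>j\<in>Poly_Mapping.keys m. \<Sum>_<Poly_Mapping.lookup m j. b j)"

text \<open>The undetermined coefficients \<open>\<lambda>\<^sub>m\<close> are variables subject to \<open>\<lambda>\<^sub>m = \<lambda>\<^sub>k\<close> whenever
  \<open>m' = k'\<close>; the common variable is indexed by the least such degree \<open>d\<close> monomial in
  \<open>X\<^sub>0, \<dots>, X\<^sub>r\<^sub>-\<^sub>1\<close>.\<close>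

definition tensor_coeff ::
  "nat \<Rightarrow> (nat, 'k::field) mpoly \<Rightarrow> nat \<Rightarrow> (nat \<Rightarrow> nat mon) \<Rightarrow> nat mon \<Rightarrow> (nat mon, 'k) ratfun" where
  "tensor_coeff d F r b m = (let \<alpha> = basis_prod b m in if mdeg \<alpha> \<le> d
     then RConst (Poly_Mapping.lookup F (Poly_Mapping.single 0 (d - mdeg \<alpha>) + \<alpha>))
     else RVar (Min {k \<in> monomials {..<r} d. basis_prod b k = \<alpha>}))"

definition sym_tensor ::
  "nat \<Rightarrow> (nat, 'k::field) mpoly \<Rightarrow> nat \<Rightarrow> (nat \<Rightarrow> nat mon) \<Rightarrow> (nat, (nat mon, 'k) ratfun) mpoly" where
  "sym_tensor d F r b = (\<Sum>m\<in>monomials {..<r} d. Poly_Mapping.single m (tensor_coeff d F r b m))"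

text \<open>Value of the symmetric multilinear form belonging to a divided power form, at the basis
  vectors with indices \<open>js\<close>: the coefficient of the divided power monomial
  \<open>\<Prod>j\<leftarrow>js. X\<^sub>j\<close>.\<close>

definition multilinear_value :: "(nat, 'a::zero) mpoly \<Rightarrow> nat list \<Rightarrow> 'a" where
  "multilinear_value P js = Poly_Mapping.lookup P (\<Sum>j\<leftarrow>js. Poly_Mapping.single j 1)"

definition tensor_mat ::
  "nat \<Rightarrow> (nat, 'k::field) mpoly \<Rightarrow> nat \<Rightarrow> (nat \<Rightarrow> nat mon) \<Rightarrow> (nat mon, 'k) ratfun mat" where
  "tensor_mat d F r b = mat r r (\<lambda>(j, k).
     multilinear_value (sym_tensor d F r b) (replicate (d - 2) 0 @ [j, k]))"

definition tensor_mat_shift ::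
  "nat \<Rightarrow> (nat, 'k::field) mpoly \<Rightarrow> nat \<Rightarrow> (nat \<Rightarrow> nat mon) \<Rightarrow> nat \<Rightarrow> (nat mon, 'k) ratfun mat" where
  "tensor_mat_shift d F r b i = mat r r (\<lambda>(j, k).
     multilinear_value (sym_tensor d F r b) (replicate (d - 3) 0 @ [i, j, k]))"

text \<open>The subtractions do not truncate where it matters: a form of degree at most \<open>2\<close> has
  cactus rank at most \<open>n + 1\<close>.\<close>

definition tensor_mult ::
  "nat \<Rightarrow> (nat, 'k::field) mpoly \<Rightarrow> nat \<Rightarrow> (nat \<Rightarrow> nat mon) \<Rightarrow> nat \<Rightarrow> (nat mon, 'k) ratfun mat" where
  "tensor_mult d F r b i =
     transpose_mat (tensor_mat_shift d F r b i * the (mat_inverse (tensor_mat d F r b)))"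

end

theory Submission
  imports Defs "Jordan_Normal_Form.Determinant"
begin

text \<open>The two constructions are the same linear system in different names for the unknowns. Since
  \<open>b 0\<close> is the monomial \<open>1\<close>, the coefficient of the tensor at \<open>X\<^sub>0\<^sup>d\<^sup>-\<^sup>2 X\<^sub>j X\<^sub>k\<close> depends only on the
  monomial \<open>b\<^sub>j b\<^sub>k\<close>, and the one at \<open>X\<^sub>0\<^sup>d\<^sup>-\<^sup>3 X\<^sub>i X\<^sub>j X\<^sub>k\<close> only on \<open>x\<^sub>i b\<^sub>j b\<^sub>k\<close>. So these matrices arise from
  the two Hankel matrices by renaming the moment variable \<open>h\<^sub>\<alpha>\<close> to the least degree \<open>d\<close> monomial in
  the \<open>X\<^sub>j\<close> that evaluates to \<open>\<alpha>\<close> (\<open>least_preimage\<close>). Evaluation of monomials, \<open>basis_prod\<close>, inverts this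
  renaming, so it is injective on the finitely many relevant \<open>\<alpha>\<close>, and it extends to a
  bijection \<open>\<Psi>\<close> of all variables (\<open>extend_inj_on_to_bij\<close>). A bijective renaming acts as a field homomorphism
  on rational functions and carries the variables of \<open>q\<close> exactly to those of its image
  (\<open>rvars_rrename\<close>). It therefore carries the solution of \<open>H\<^sub>i = M\<^sup>t H\<close> to the solution of the renamed
  system, which is the tensor construction.

  Two things need proof. First, the solution has to be unique, that is, \<open>det H \<noteq> 0\<close>
  (\<open>hankel_det_nonzero\<close>): specializing \<open>h\<^sub>\<alpha>\<close> to \<open>\<Lambda>(x\<^sup>\<alpha>)\<close> turns \<open>H\<close> into the Gram matrix of the pairing
  \<open>(p, q) \<mapsto> \<Lambda>(pq)\<close> on \<open>R/Ann(\<Lambda>)\<close>, which is nondegenerate (\<open>gram_det_nonzero\<close>).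

  Second, the exponents \<open>d - 2\<close> and \<open>d - 3\<close> only make sense for \<open>d \<ge> 3\<close>. A form of degree
  at most \<open>2\<close> has cactus rank at most \<open>n + 1\<close> (\<open>cactus_rank_le_of_degree_le_2\<close>): a quadratic form can
  be diagonalized (\<open>symmetric_form_diagonalization\<close>), which expresses it as a combination of
  evaluations at \<open>n + 1\<close> linearly independent points, and the ideal of these points is apolar to it
  and has Hilbert function \<open>n + 1\<close> in every positive degree
  (\<open>hilbert_function_points_ideal\<close>).\<close>

section \<open>Homomorphisms out of polynomial rings\<close>

definition monval :: "('v \<Rightarrow> 'a::comm_ring_1) \<Rightarrow> 'v mon \<Rightarrow> 'a" where
  "monval x m = (\<Prod>v\<in>Poly_Mapping.keys m. x v ^ Poly_Mapping.lookup m v)"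

text \<open>Substitution,
  specialization of the moment variables, and restriction to a line in affine space are all
  instances, so multiplicativity is shown only once.\<close>

definition peval :: "('k::comm_ring_1 \<Rightarrow> 'a::comm_ring_1) \<Rightarrow> ('v \<Rightarrow> 'a) \<Rightarrow> ('v, 'k) mpoly \<Rightarrow> 'a" where
  "peval h x p = (\<Sum>m\<in>Poly_Mapping.keys p. h (Poly_Mapping.lookup p m) * monval x m)"

lemma psubst_eq_peval: "psubst \<sigma> = peval PConst \<sigma>"
  by (simp add: fun_eq_iff psubst_def peval_def monval_def)

lemma sum_lookup_single:
  fixes p :: "('v, 'k::comm_monoid_add) mpoly"
  shows "(\<Sum>m\<in>Poly_Mapping.keys p. Poly_Mapping.single m (Poly_Mapping.lookup p m)) = p"
proof (rule poly_mapping_eqI)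
  fix k
  have "(\<Sum>m\<in>Poly_Mapping.keys p. Poly_Mapping.lookup (Poly_Mapping.single m (Poly_Mapping.lookup p m)) k) =
    (\<Sum>m\<in>Poly_Mapping.keys p. if m = k then Poly_Mapping.lookup p k else 0)"
    by (intro sum.cong) (auto simp: lookup_single when_def)
  also have "\<dots> = Poly_Mapping.lookup p k"
    by (auto simp: in_keys_iff)
  finally show "Poly_Mapping.lookup (\<Sum>m\<in>Poly_Mapping.keys p. Poly_Mapping.single m (Poly_Mapping.lookup p m)) k
      = Poly_Mapping.lookup p k"
    by (simp add: lookup_sum)
qed

lemma monval_superset:
  assumes "finite A" "Poly_Mapping.keys m \<subseteq> A"
  shows "monval x m = (\<Prod>v\<in>A. x v ^ Poly_Mapping.lookup m v)"
  unfolding monval_def using assms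
  by (intro prod.mono_neutral_left) (auto simp: in_keys_iff)

lemma monval_add: "monval x (m + m') = monval x m * monval x m'"
proof -
  let ?A = "Poly_Mapping.keys m \<union> Poly_Mapping.keys m'"
  have "Poly_Mapping.keys (m + m') \<subseteq> ?A" by (rule keys_add)
  then show ?thesis
    by (simp add: monval_superset[of ?A] lookup_add power_add prod.distrib)
qed

lemma monval_0 [simp]: "monval x 0 = 1"
  by (simp add: monval_def)

lemma monval_single [simp]: "monval x (Poly_Mapping.single v k) = x v ^ k"
  by (cases "k = 0") (auto simp: monval_def)

context comm_ring_hom
begin

lemma peval_superset:
  assumes "finite A" "Poly_Mapping.keys p \<subseteq> A"
  shows "peval hom x p = (\<Sum>m\<in>A. hom (Poly_Mapping.lookup p m) * monval x m)"
  unfolding peval_def using assms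
  by (intro sum.mono_neutral_left) (auto simp: in_keys_iff)

lemma peval_add: "peval hom x (p + q) = peval hom x p + peval hom x q"
proof -
  let ?A = "Poly_Mapping.keys p \<union> Poly_Mapping.keys q"
  have "Poly_Mapping.keys (p + q) \<subseteq> ?A" by (rule keys_add)
  then show ?thesis
    by (simp add: peval_superset[of ?A] lookup_add hom_add distrib_right sum.distrib)
qed

lemma peval_single: "peval hom x (Poly_Mapping.single m c) = hom c * monval x m"
  by (cases "c = 0") (auto simp: peval_def)

lemma peval_0 [simp]: "peval hom x 0 = 0"
  by (simp add: peval_def)

lemma peval_sum: "peval hom x (sum f A) = (\<Sum>a\<in>A. peval hom x (f a))"
  by (induction A rule: infinite_finite_induct) (auto simp: peval_add)

lemma peval_mult: "peval hom x (p * q) = peval hom x p * peval hom x q"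
proof -
  let ?s = "\<lambda>p m. Poly_Mapping.single m (Poly_Mapping.lookup p m)"
  have "p * q = (\<Sum>m\<in>Poly_Mapping.keys p. ?s p m) * (\<Sum>l\<in>Poly_Mapping.keys q. ?s q l)"
    by (simp add: sum_lookup_single)
  also have "\<dots> = (\<Sum>m\<in>Poly_Mapping.keys p. \<Sum>l\<in>Poly_Mapping.keys q. Poly_Mapping.single (m + l)
      (Poly_Mapping.lookup p m * Poly_Mapping.lookup q l))"
    by (simp add: sum_product mult_single)
  finally have "peval hom x (p * q) = (\<Sum>m\<in>Poly_Mapping.keys p. \<Sum>l\<in>Poly_Mapping.keys q.
      (hom (Poly_Mapping.lookup p m) * monval x m) * (hom (Poly_Mapping.lookup q l) * monval x l))"
    by (simp add: peval_sum peval_single hom_mult monval_add mult_ac)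
  then show ?thesis
    by (simp add: peval_def sum_product)
qed

lemma peval_1 [simp]: "peval hom x 1 = 1"
  using peval_single[of x 0 1] by simp

lemma comm_ring_hom_peval: "comm_ring_hom (peval hom x)"
  by unfold_locales (auto simp: peval_add peval_mult)

end

lemma PConst_hom: "comm_ring_hom (PConst :: 'k::comm_ring_1 \<Rightarrow> ('v, 'k) mpoly)"
  by unfold_locales (auto simp: PConst_def single_add mult_single)

lemma id_hom: "comm_ring_hom (\<lambda>c::'k::comm_ring_1. c)"
  by unfold_locales auto

lemma psubst_hom: "comm_ring_hom (psubst \<sigma> :: ('v, 'k::comm_ring_1) mpoly \<Rightarrow> ('w, 'k) mpoly)"
  unfolding psubst_eq_peval by (rule comm_ring_hom.comm_ring_hom_peval[OF PConst_hom])

lemma mpoly_hom_eqI: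
  fixes f g :: "('v, 'k::comm_ring_1) mpoly \<Rightarrow> 'a::comm_ring_1"
  assumes "comm_ring_hom f" "comm_ring_hom g"
    and "\<And>c. f (PConst c) = g (PConst c)" "\<And>v. v \<in> pvars p \<Longrightarrow> f (PVar v) = g (PVar v)"
  shows "f p = g p"
proof -
  interpret f: comm_ring_hom f by fact
  interpret g: comm_ring_hom g by fact
  have mon: "PMon m = (\<Prod>v\<in>Poly_Mapping.keys m. PVar v ^ Poly_Mapping.lookup m v :: ('v, 'k) mpoly)" for m :: "'v mon"
  proof -
    have pw: "PVar v ^ j = (Poly_Mapping.single (Poly_Mapping.single v j) 1 :: ('v, 'k) mpoly)" for v :: 'v and j
      by (induction j) (auto simp: PVar_def PMon_def mult_single simp flip: single_add)
    have pr: "(\<Prod>v\<in>A. Poly_Mapping.single (s v) 1) = (Poly_Mapping.single (sum s A) 1 :: ('v, 'k) mpoly)"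
      if "finite A" for s :: "'v \<Rightarrow> 'v mon" and A
      using that by (induction A) (auto simp: mult_single)
    have "(\<Sum>v\<in>Poly_Mapping.keys m. Poly_Mapping.single v (Poly_Mapping.lookup m v)) = m"
    proof (rule poly_mapping_eqI)
      fix k
      have "(\<Sum>v\<in>Poly_Mapping.keys m. Poly_Mapping.lookup (Poly_Mapping.single v (Poly_Mapping.lookup m v)) k) =
        (\<Sum>v\<in>Poly_Mapping.keys m. if v = k then Poly_Mapping.lookup m k else 0)"
        by (intro sum.cong) (auto simp: lookup_single when_def)
      then show "Poly_Mapping.lookup (\<Sum>v\<in>Poly_Mapping.keys m. Poly_Mapping.single v (Poly_Mapping.lookup m v)) k
          = Poly_Mapping.lookup m k"
        by (auto simp: lookup_sum in_keys_iff)
    qed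
    then show ?thesis by (simp add: PMon_def pw pr)
  qed
  have decomp: "(\<Sum>m\<in>Poly_Mapping.keys p. PConst (Poly_Mapping.lookup p m) * PMon m) = p"
    using sum_lookup_single[of p] by (simp add: PConst_def PMon_def mult_single)
  have "f (\<Sum>m\<in>Poly_Mapping.keys p. PConst (Poly_Mapping.lookup p m) * PMon m) =
        g (\<Sum>m\<in>Poly_Mapping.keys p. PConst (Poly_Mapping.lookup p m) * PMon m)"
    unfolding f.hom_sum g.hom_sum f.hom_mult g.hom_mult mon f.hom_prod g.hom_prod f.hom_power g.hom_power
    using assms(4) by (intro sum.cong prod.cong arg_cong2[where f="(*)"] arg_cong2[where f="(^)"] assms(3))
      (auto simp: pvars_def)
  then show ?thesis unfolding decomp .
qed

lemma pvars_add: "pvars (p + q) \<subseteq> pvars p \<union> pvars q"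
  using keys_add[of p q] by (auto simp: pvars_def)

lemma pvars_mult: "pvars (p * q) \<subseteq> pvars p \<union> pvars q"
proof -
  have "v \<in> pvars p \<union> pvars q" if "m \<in> Poly_Mapping.keys (p * q)" "v \<in> Poly_Mapping.keys m" for m v
  proof -
    from that(1) keys_mult[of p q] obtain a b where "m = a + b" "a \<in> Poly_Mapping.keys p" "b \<in> Poly_Mapping.keys q"
      by auto
    then show ?thesis using that(2) keys_add[of a b] by (auto simp: pvars_def)
  qed
  then show ?thesis unfolding pvars_def[of "p * q"] by blast
qed

lemma pvars_uminus [simp]: "pvars (- p) = pvars (p :: ('v, 'k::comm_ring_1) mpoly)"
  by (simp add: pvars_def keys.rep_eq)

lemma pvars_0 [simp]: "pvars 0 = {}" by (simp add: pvars_def)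
lemma pvars_1 [simp]: "pvars (1 :: ('v, 'k::comm_ring_1) mpoly) = {}" by (simp add: pvars_def)
lemma pvars_PConst [simp]: "pvars (PConst c) = {}" by (simp add: pvars_def PConst_def)
lemma pvars_PMon [simp]: "pvars (PMon m :: ('v, 'k::comm_ring_1) mpoly) = Poly_Mapping.keys m"
  by (simp add: pvars_def PMon_def)

lemma pvars_sum: "pvars (sum f A) \<subseteq> (\<Union>a\<in>A. pvars (f a))"
proof (induction A rule: infinite_finite_induct)
  case (insert a A)
  then show ?case using pvars_add[of "f a" "sum f A"] by auto
qed auto

lemma pvars_prod: "pvars (prod f A :: ('v, 'k::comm_ring_1) mpoly) \<subseteq> (\<Union>a\<in>A. pvars (f a))"
proof (induction A rule: infinite_finite_induct)
  case (insert a A)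
  then show ?case using pvars_mult[of "f a" "prod f A"] by auto
qed auto

lemma pvars_power: "pvars (p ^ k :: ('v, 'k::comm_ring_1) mpoly) \<subseteq> pvars p"
  using pvars_prod[of "\<lambda>_. p" "{..<k}"] by (auto split: if_splits)

lemma mdeg_superset:
  assumes "finite A" "Poly_Mapping.keys m \<subseteq> A"
  shows "mdeg m = (\<Sum>v\<in>A. Poly_Mapping.lookup m v)"
  unfolding mdeg_def using assms
  by (intro sum.mono_neutral_left) (auto simp: in_keys_iff)

lemma mdeg_add: "mdeg (m + m') = mdeg m + mdeg m'"
proof -
  let ?A = "Poly_Mapping.keys m \<union> Poly_Mapping.keys m'"
  have "Poly_Mapping.keys (m + m') \<subseteq> ?A" by (rule keys_add)
  then show ?thesis
    by (simp add: mdeg_superset[of ?A] lookup_add sum.distrib)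
qed

lemma mdeg_0 [simp]: "mdeg 0 = 0" by (simp add: mdeg_def)
lemma mdeg_single [simp]: "mdeg (Poly_Mapping.single v k) = k"
  by (cases "k = 0") (auto simp: mdeg_def)

lemma mdeg_eq_0_iff [simp]: "mdeg m = 0 \<longleftrightarrow> m = 0"
  by (auto simp: mdeg_def in_keys_iff intro!: poly_mapping_eqI)

lemma mdeg_Suc_obtain:
  assumes "mdeg m = Suc t"
  obtains v m' where "v \<in> Poly_Mapping.keys m" "m = Poly_Mapping.single v 1 + m'" "mdeg m' = t"
    "Poly_Mapping.keys m' \<subseteq> Poly_Mapping.keys m"
proof -
  from assms have "m \<noteq> 0" by auto
  then obtain v where v: "v \<in> Poly_Mapping.keys m" by fastforce
  define m' where "m' = m - Poly_Mapping.single v 1"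
  have m: "m = Poly_Mapping.single v 1 + m'"
    by (rule poly_mapping_eqI) (use v in \<open>auto simp: m'_def lookup_add lookup_minus lookup_single when_def in_keys_iff\<close>)
  have "mdeg m' = t"
    using assms unfolding m by (simp add: mdeg_add)
  moreover have "Poly_Mapping.keys m' \<subseteq> Poly_Mapping.keys m"
    by (auto simp: m'_def in_keys_iff lookup_minus)
  ultimately show ?thesis using that v m by blast
qed

lemma finite_monomials: "finite V \<Longrightarrow> finite (monomials V t)"
proof (induction t)
  case 0
  have "monomials V 0 \<subseteq> {0}" by (auto simp: monomials_def)
  then show ?case using finite_subset by blast
next
  case (Suc t)
  have "monomials V (Suc t) \<subseteq> (\<lambda>(v, m). Poly_Mapping.single v 1 + m) ` (V \<times> monomials V t)"
  proof
    fix m assume m: "m \<in> monomials V (Suc t)"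
    then have "mdeg m = Suc t" by (simp add: monomials_def)
    then show "m \<in> (\<lambda>(v, m). Poly_Mapping.single v 1 + m) ` (V \<times> monomials V t)"
      by (rule mdeg_Suc_obtain) (use m in \<open>auto simp: monomials_def image_iff intro!: bexI\<close>)
  qed
  then show ?case using Suc by (meson finite_SigmaI finite_imageI finite_subset)
qed

section \<open>Diagonalization of symmetric bilinear forms\<close>

text \<open>The rows of \<open>A\<close> are linear functionals in which the form is diagonal, and the rows of \<open>B\<close> the
  dual basis. Zero coefficients \<open>c k\<close> are allowed, so the form may be degenerate. The proof splits
  off a nonisotropic vector \<open>v\<close>: with \<open>w = Q(v, -)\<close> and \<open>q = Q(v, v)\<close>, the form
  \<open>Q' = Q - w \<otimes> w / q\<close> has \<open>v\<close> in its kernel. As \<open>v\<close> has \<open>i\<close>-th coordinate \<open>1\<close>, \<open>Q'\<close> is the pullback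
  of its restriction to the other coordinates along the projection with kernel \<open>v\<close>,
  and the induction hypothesis applies to this restriction.\<close>

lemma symmetric_form_diagonalization:
  fixes Q :: "'i \<Rightarrow> 'i \<Rightarrow> 'k::field"
  assumes "finite I" "(2::'k) \<noteq> 0" "\<forall>i\<in>I. \<forall>j\<in>I. Q i j = Q j i"
  shows "\<exists>A B c. (\<forall>i\<in>I. \<forall>j\<in>I. Q i j = (\<Sum>k\<in>I. c k * A k i * A k j)) \<and>
    (\<forall>a\<in>I. \<forall>b\<in>I. (\<Sum>j\<in>I. A a j * B b j) = (if a = b then 1 else 0))"
  using assms(1,3)
proof (induction "card I" arbitrary: I Q rule: less_induct)
  case less
  note fin = less.prems(1) and sym = less.prems(2)
  show ?case
  proof (cases "\<forall>i\<in>I. \<forall>j\<in>I. Q i j = 0")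
    case True
    show ?thesis
      by (rule exI[of _ "\<lambda>a j. if a = j then 1 else 0"], rule exI[of _ "\<lambda>a j. if a = j then 1 else 0"],
          rule exI[of _ "\<lambda>_. 0"]) (use True fin in \<open>auto simp: if_distrib[of "\<lambda>x. x * _"] cong: if_cong\<close>)
  next
    case False
    obtain i v where i: "i \<in> I" and vi: "v i = 1"
      and nz: "(\<Sum>y\<in>I. v y * (\<Sum>x\<in>I. v x * Q x y)) \<noteq> 0"
    proof (cases "\<exists>i\<in>I. Q i i \<noteq> 0")
      case True
      then obtain i where "i \<in> I" "Q i i \<noteq> 0" by blast
      then show ?thesis using fin
        by (intro that[of i "\<lambda>x. if x = i then 1 else 0"]) (auto simp: if_distrib[of "\<lambda>x. x * _"] cong: if_cong)
    next
      case diag: False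
      from False obtain i j where ij: "i \<in> I" "j \<in> I" "Q i j \<noteq> 0" by blast
      with diag have ne: "i \<noteq> j" by blast
      \<comment> \<open>All \<open>e\<^sub>x\<close> are isotropic, so by polarization \<open>e\<^sub>i + e\<^sub>j\<close> is not.\<close>
      let ?v = "\<lambda>x. (if x = i then 1 else 0) + (if x = j then 1 else (0::'k))"
      have "(\<Sum>y\<in>I. ?v y * (\<Sum>x\<in>I. ?v x * Q x y)) = (Q i i + Q j i) + (Q i j + Q j j)"
        using fin ij by (simp add: distrib_right sum.distrib if_distrib[of "\<lambda>x. x * _"] cong: if_cong)
      also have "\<dots> = 2 * Q i j" using diag ij sym by (auto simp: algebra_simps)
      finally show ?thesis using ij ne assms(2) by (intro that[of i ?v]) auto
    qed
    define w where "w y = (\<Sum>x\<in>I. v x * Q x y)" for y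
    define q where "q = (\<Sum>y\<in>I. v y * w y)"
    define Q' where "Q' x y = Q x y - w x * w y / q" for x y
    define J where "J = I - {i}"
    have q0: "q \<noteq> 0" using nz by (simp add: q_def w_def)
    have I: "I = insert i J" "i \<notin> J" and finJ: "finite J" using i fin by (auto simp: J_def)
    have sym': "Q' x y = Q' y x" if "x \<in> I" "y \<in> I" for x y
      using that sym by (auto simp: Q'_def)
    have ker: "(\<Sum>x\<in>I. v x * Q' x y) = 0" for y
    proof -
      have "(\<Sum>x\<in>I. v x * Q' x y) = (\<Sum>x\<in>I. v x * Q x y) - (\<Sum>x\<in>I. v x * w x) * w y / q"
        by (simp add: Q'_def right_diff_distrib sum_subtractf sum_distrib_right sum_divide_distrib mult.assoc)
      then show ?thesis using q0 by (simp flip: q_def w_def)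
    qed
    have lt: "card J < card I" unfolding J_def by (rule card_Diff1_less[OF fin i])
    have "\<forall>x\<in>J. \<forall>y\<in>J. Q' x y = Q' y x" using sym' I by blast
    from less.hyps[OF lt finJ this] obtain A' B' c' where
      decJ: "\<forall>x\<in>J. \<forall>y\<in>J. Q' x y = (\<Sum>k\<in>J. c' k * A' k x * A' k y)" and
      dualJ: "\<forall>a\<in>J. \<forall>b\<in>J. (\<Sum>j\<in>J. A' a j * B' b j) = (if a = b then 1 else 0)"
      by (elim exE conjE)
    note dec = decJ[rule_format] and dual = dualJ[rule_format]
    \<comment> \<open>Coordinate \<open>l\<close> of the image of the basis vector \<open>e\<^sub>x\<close> under the projection along \<open>v\<close>.\<close>
    define P where "P x l = (if x = i then - v l else if x = l then 1 else 0)" for x l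
    define E where "E k x = (\<Sum>l\<in>J. A' k l * P x l)" for k x
    \<comment> \<open>The dual vectors on \<open>J\<close>, extended by zero; subtracting multiples of \<open>v\<close> then makes \<open>w\<close> vanish on them.\<close>
    define G where "G k x = (if x = i then 0 else B' k x)" for k x
    define \<beta> where "\<beta> k = (\<Sum>x\<in>I. w x * G k x)" for k
    have proj: "Q' x y = (\<Sum>l\<in>J. P x l * Q' l y)" if "x \<in> I" for x y
    proof (cases "x = i")
      case True
      have "Q' i y + (\<Sum>l\<in>J. v l * Q' l y) = 0" using ker[of y] finJ I vi by simp
      then show ?thesis using True by (simp add: P_def sum_negf eq_neg_iff_add_eq_0)
    next
      case False
      with that have "x \<in> J" by (simp add: J_def)
      then show ?thesis using False finJ by (simp add: P_def if_distrib[of "\<lambda>x. x * _"] cong: if_cong)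
    qed
    have Q'E: "Q' x y = (\<Sum>k\<in>J. c' k * E k x * E k y)" if "x \<in> I" "y \<in> I" for x y
    proof -
      have "Q' x y = (\<Sum>l\<in>J. P x l * Q' y l)"
        using proj[OF that(1)] sym' that by (simp add: J_def)
      also have "\<dots> = (\<Sum>l\<in>J. P x l * (\<Sum>m\<in>J. P y m * Q' m l))"
        using proj[OF that(2)] by simp
      also have "\<dots> = (\<Sum>l\<in>J. \<Sum>m\<in>J. \<Sum>k\<in>J. c' k * (A' k l * P x l) * (A' k m * P y m))"
        by (simp add: dec sum_distrib_left mult_ac)
      also have "\<dots> = (\<Sum>l\<in>J. \<Sum>k\<in>J. \<Sum>m\<in>J. c' k * (A' k l * P x l) * (A' k m * P y m))"
        by (intro sum.cong refl sum.swap)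
      also have "\<dots> = (\<Sum>k\<in>J. \<Sum>l\<in>J. \<Sum>m\<in>J. c' k * (A' k l * P x l) * (A' k m * P y m))"
        by (rule sum.swap)
      also have "\<dots> = (\<Sum>k\<in>J. c' k * E k x * E k y)"
        by (intro sum.cong) (simp_all add: E_def sum_distrib_left sum_distrib_right mult_ac)
      finally show ?thesis .
    qed
    have Ev: "(\<Sum>x\<in>I. E k x * v x) = 0" for k
    proof -
      have "(\<Sum>x\<in>I. E k x * v x) = (\<Sum>x\<in>I. \<Sum>l\<in>J. A' k l * (P x l * v x))"
        by (simp add: E_def sum_distrib_right mult.assoc)
      also have "\<dots> = (\<Sum>l\<in>J. A' k l * (\<Sum>x\<in>I. P x l * v x))"
        by (subst sum.swap) (simp add: sum_distrib_left)
      also have "\<dots> = (\<Sum>l\<in>J. 0)"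
      proof (intro sum.cong refl)
        fix l assume l: "l \<in> J"
        have "(\<Sum>x\<in>J. P x l * v x) = (\<Sum>x\<in>J. if x = l then v l else 0)"
          using I by (intro sum.cong) (auto simp: P_def)
        then have "(\<Sum>x\<in>I. P x l * v x) = 0"
          using l finJ I vi by (simp add: P_def)
        then show "A' k l * (\<Sum>x\<in>I. P x l * v x) = 0" by simp
      qed
      finally show ?thesis by simp
    qed
    have EG: "(\<Sum>x\<in>I. E a x * G b x) = (if a = b then 1 else 0)" if "a \<in> J" "b \<in> J" for a b
    proof -
      have EJ: "E a x = A' a x" if "x \<in> J" for x
      proof -
        have "E a x = (\<Sum>l\<in>J. if l = x then A' a x else 0)"
          unfolding E_def using that I by (intro sum.cong) (auto simp: P_def)
        then show ?thesis using that finJ by simp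
      qed
      have "(\<Sum>x\<in>I. E a x * G b x) = (\<Sum>x\<in>J. E a x * G b x)"
        using I finJ by (simp add: G_def)
      also have "\<dots> = (\<Sum>x\<in>J. A' a x * B' b x)"
        using I EJ by (intro sum.cong) (auto simp: G_def)
      finally show ?thesis using dual that by simp
    qed
    define A where "A k x = (if k = i then w x else E k x)" for k x
    define B where "B k x = (if k = i then v x / q else G k x - \<beta> k / q * v x)" for k x
    define c where "c k = (if k = i then 1 / q else c' k)" for k
    show ?thesis
    proof (rule exI[of _ A], rule exI[of _ B], rule exI[of _ c], intro conjI ballI)
      fix x y assume xy: "x \<in> I" "y \<in> I"
      have "(\<Sum>k\<in>J. c k * A k x * A k y) = Q' x y"
        unfolding Q'E[OF xy] using I by (intro sum.cong) (auto simp: c_def A_def)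
      then have "(\<Sum>k\<in>I. c k * A k x * A k y) = w x * w y / q + Q' x y"
        using I finJ by (simp add: c_def A_def)
      then show "Q x y = (\<Sum>k\<in>I. c k * A k x * A k y)" by (simp add: Q'_def)
    next
      fix a b' assume ab: "a \<in> I" "b' \<in> I"
      have wv: "(\<Sum>j\<in>I. w j * v j) = q" by (simp add: q_def mult.commute)
      have split: "(\<Sum>j\<in>I. f j * (G b' j - \<beta> b' / q * v j)) =
         (\<Sum>j\<in>I. f j * G b' j) - \<beta> b' / q * (\<Sum>j\<in>I. f j * v j)" for f :: "'i \<Rightarrow> 'k"
        by (simp add: right_diff_distrib sum_subtractf sum_distrib_left mult_ac)
      have div: "(\<Sum>j\<in>I. f j * (v j / q)) = (\<Sum>j\<in>I. f j * v j) / q" for f :: "'i \<Rightarrow> 'k"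
        by (simp add: sum_divide_distrib)
      consider "a = i" "b' = i" | "a = i" "b' \<in> J" | "a \<in> J" "b' = i" | "a \<in> J" "b' \<in> J"
        using ab by (auto simp: J_def)
      then show "(\<Sum>j\<in>I. A a j * B b' j) = (if a = b' then 1 else 0)"
      proof cases
        case 1
        then have "(\<Sum>j\<in>I. A a j * B b' j) = (\<Sum>j\<in>I. w j * (v j / q))" by (simp add: A_def B_def)
        then show ?thesis using 1 q0 unfolding div wv by simp
      next
        case 2
        then have "b' \<noteq> i" using I by auto
        with 2 have "(\<Sum>j\<in>I. A a j * B b' j) = (\<Sum>j\<in>I. w j * (G b' j - \<beta> b' / q * v j))"
          by (simp add: A_def B_def)
        then show ?thesis using 2 q0 \<open>b' \<noteq> i\<close> unfolding split wv by (simp add: \<beta>_def)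
      next
        case 3
        then have "a \<noteq> i" using I by auto
        with 3 have "(\<Sum>j\<in>I. A a j * B b' j) = (\<Sum>j\<in>I. E a j * (v j / q))" by (simp add: A_def B_def)
        then show ?thesis using 3 \<open>a \<noteq> i\<close> unfolding div Ev by simp
      next
        case 4
        then have "a \<noteq> i" "b' \<noteq> i" using I by auto
        then have "(\<Sum>j\<in>I. A a j * B b' j) = (\<Sum>j\<in>I. E a j * (G b' j - \<beta> b' / q * v j))"
          by (simp add: A_def B_def)
        then show ?thesis unfolding split Ev EG[OF 4] by simp
      qed
    qed
  qed
qed

section \<open>Linearly independent points and forms of degree at most two\<close>

lemma const_poly_hom: "comm_ring_hom (\<lambda>c::'k::comm_ring_1. [:c:])"
  by unfold_locales (auto simp: one_pCons)

text \<open>The restriction of a polynomial to the line through the origin and \<open>x\<close>, as a polynomial in the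
  parameter of the line. It vanishes iff all homogeneous components vanish at \<open>x\<close>, so its kernel is
  visibly both an ideal and homogeneous.\<close>

definition cone_eval :: "('v \<Rightarrow> 'k::field) \<Rightarrow> ('v, 'k) mpoly \<Rightarrow> 'k poly" where
  "cone_eval x = peval (\<lambda>c. [:c:]) (\<lambda>v. monom (x v) 1)"

lemma cone_eval_hom: "comm_ring_hom (cone_eval x)"
  unfolding cone_eval_def by (rule comm_ring_hom.comm_ring_hom_peval[OF const_poly_hom])

lemma cone_eval_single:
  fixes x :: "'v \<Rightarrow> 'k::field"
  shows "cone_eval x (Poly_Mapping.single m c) = monom (c * monval x m) (mdeg m)"
proof -
  have "(\<Prod>v\<in>A. monom (x v) 1 ^ f v) = monom (\<Prod>v\<in>A. x v ^ f v) (sum f A)"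
    if "finite A" for A :: "'v set" and f
    using that by (induction A) (auto simp: monom_power mult_monom)
  then have "monval (\<lambda>v. monom (x v) 1) m = monom (monval x m) (mdeg m)"
    by (simp add: monval_def mdeg_def)
  then show ?thesis
    unfolding cone_eval_def comm_ring_hom.peval_single[OF const_poly_hom]
    by (simp add: smult_monom)
qed

lemma cone_eval_expand:
  "cone_eval x p = (\<Sum>m\<in>Poly_Mapping.keys p. monom (Poly_Mapping.lookup p m * monval x m) (mdeg m))"
proof -
  interpret comm_ring_hom "cone_eval x" by (rule cone_eval_hom)
  show ?thesis
    by (subst (1) sum_lookup_single[of p, symmetric]) (simp only: hom_sum cone_eval_single)
qed

lemma cone_eval_pcomponent:
  "cone_eval x (pcomponent t p) = monom (coeff (cone_eval x p) t) t"
proof -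
  interpret comm_ring_hom "cone_eval x" by (rule cone_eval_hom)
  have "cone_eval x (pcomponent t p) =
      (\<Sum>m\<in>{m \<in> Poly_Mapping.keys p. mdeg m = t}. monom (Poly_Mapping.lookup p m * monval x m) t)"
    unfolding pcomponent_def hom_sum cone_eval_single by (intro sum.cong) auto
  also have "\<dots> = monom (\<Sum>m\<in>{m \<in> Poly_Mapping.keys p. mdeg m = t}. Poly_Mapping.lookup p m * monval x m) t"
    by (intro poly_eqI) (simp add: coeff_sum)
  also have "(\<Sum>m\<in>{m \<in> Poly_Mapping.keys p. mdeg m = t}. Poly_Mapping.lookup p m * monval x m) =
      (\<Sum>m\<in>Poly_Mapping.keys p. if mdeg m = t then Poly_Mapping.lookup p m * monval x m else 0)"
    by (subst sum.inter_filter[symmetric]) auto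
  also have "\<dots> = coeff (cone_eval x p) t"
    by (simp add: cone_eval_expand coeff_sum)
  finally show ?thesis .
qed

lemma cone_eval_forms:
  assumes "p \<in> forms V t"
  shows "cone_eval x p = monom (coeff (cone_eval x p) t) t"
proof -
  have "pcomponent t p = p"
    using assms sum_lookup_single[of p]
    by (subst (asm) sum.cong[OF _ refl, of _ "{m \<in> Poly_Mapping.keys p. mdeg m = t}"])
      (auto simp: forms_def monomials_def pcomponent_def)
  then show ?thesis using cone_eval_pcomponent[of x t p] by simp
qed

lemma poly_ring_simps [simp]:
  "carrier (poly_ring V) = {p. pvars p \<subseteq> V}" "mult (poly_ring V) = (*)" "one (poly_ring V) = 1"
  "zero (poly_ring V) = 0" "add (poly_ring V) = (+)"
  by (simp_all add: poly_ring_def)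

lemma ring_poly_ring: "ring (poly_ring V :: ('v, 'k::comm_ring_1) mpoly ring)"
proof (rule ringI)
  show "abelian_group (poly_ring V :: ('v, 'k) mpoly ring)"
  proof (rule abelian_groupI, goal_cases)
    case (1 p q) then show ?case using pvars_add[of p q] by auto
  next
    case (6 p) then show ?case by (intro bexI[of _ "- p"]) auto
  qed (auto simp: add_ac)
  show "Group.monoid (poly_ring V :: ('v, 'k) mpoly ring)"
  proof (rule monoidI, goal_cases)
    case (1 p q) then show ?case using pvars_mult[of p q] by auto
  qed (auto simp: mult_ac)
qed (auto simp: algebra_simps)

lemma forms_subspace: "poly_vs.subspace (forms V t :: ('v, 'k::field) mpoly set)"
proof -
  have "Poly_Mapping.keys (PConst c * p) \<subseteq> Poly_Mapping.keys p" for c :: 'k and p :: "('v, 'k) mpoly"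
    using keys_mult[of "PConst c" p] by (cases "c = 0") (auto simp: PConst_def)
  then show ?thesis
    unfolding poly_vs.subspace_def forms_def
    by (auto dest!: subsetD[OF keys_add])
qed

lemma forms_subset_span:
  "(forms V t :: ('v, 'k::field) mpoly set) \<subseteq> poly_vs.span (PMon ` monomials V t)"
proof
  fix p :: "('v, 'k::field) mpoly" assume p: "p \<in> forms V t"
  have "(\<Sum>m\<in>Poly_Mapping.keys p. PConst (Poly_Mapping.lookup p m) * PMon m) \<in> poly_vs.span (PMon ` monomials V t)"
    using p by (intro poly_vs.span_sum poly_vs.span_scale poly_vs.span_base) (auto simp: forms_def)
  then show "p \<in> poly_vs.span (PMon ` monomials V t)"
    using sum_lookup_single[of p] by (simp add: PConst_def PMon_def mult_single)
qed

lemma forms_mult: "p \<in> forms V s \<Longrightarrow> q \<in> forms V t \<Longrightarrow> p * q \<in> forms V (s + t)"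
  unfolding forms_def monomials_def
  using keys_mult[of p q] by (fastforce simp: mdeg_add dest: subsetD[OF keys_add])

lemma forms_power: "p \<in> forms V s \<Longrightarrow> (p :: ('v, 'k::comm_ring_1) mpoly) ^ t \<in> forms V (t * s)"
  by (induction t) (auto simp: forms_mult, auto simp: forms_def monomials_def)

lemma forms_imp_carrier: "p \<in> forms V t \<Longrightarrow> pvars p \<subseteq> V"
  by (auto simp: forms_def monomials_def pvars_def)

definition points_ideal :: "nat \<Rightarrow> (nat \<Rightarrow> nat \<Rightarrow> 'k::field) \<Rightarrow> (nat, 'k) mpoly set" where
  "points_ideal n A = {p. pvars p \<subseteq> {..n} \<and> (\<forall>a\<le>n. cone_eval (A a) p = 0)}"

text \<open>The dual forms \<open>B b\<close> witness that the points \<open>A a\<close> are linearly independent, and their powers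
  separate the points in every positive degree.\<close>

locale dual_points =
  fixes n :: nat and A B :: "nat \<Rightarrow> nat \<Rightarrow> 'k::field"
  assumes dual: "\<And>a b. a \<le> n \<Longrightarrow> b \<le> n \<Longrightarrow> (\<Sum>j\<le>n. A a j * B b j) = (if a = b then 1 else 0)"
begin

definition dual_form :: "nat \<Rightarrow> (nat, 'k) mpoly" where
  "dual_form b = (\<Sum>j\<le>n. Poly_Mapping.single (Poly_Mapping.single j 1) (B b j))"

lemma dual_form_forms: "dual_form b \<in> forms {..n} 1"
  unfolding dual_form_def
  by (intro poly_vs.subspace_sum[OF forms_subspace]) (auto simp: forms_def monomials_def)

lemma cone_eval_dual_form:
  assumes "a \<le> n" "b \<le> n"
  shows "cone_eval (A a) (dual_form b) = monom (if a = b then 1 else 0) 1"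
proof -
  interpret comm_ring_hom "cone_eval (A a)" by (rule cone_eval_hom)
  have "cone_eval (A a) (dual_form b) = (\<Sum>j\<le>n. monom (A a j * B b j) 1)"
    by (simp add: dual_form_def hom_sum cone_eval_single mult.commute)
  also have "\<dots> = monom (\<Sum>j\<le>n. A a j * B b j) 1"
    by (intro poly_eqI) (simp add: coeff_sum)
  finally show ?thesis using dual[OF assms] by simp
qed

lemma cone_eval_dual_form_power:
  assumes "a \<le> n" "b \<le> n" "t > 0"
  shows "cone_eval (A a) (dual_form b ^ t) = monom (if a = b then 1 else 0) t"
proof -
  interpret comm_ring_hom "cone_eval (A a)" by (rule cone_eval_hom)
  show ?thesis using assms by (auto simp: hom_power cone_eval_dual_form monom_power)
qed

text \<open>Saturation holds because \<open>K[t]\<close> is a domain: for each of the points, a power of the dual form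
  belonging to it does not vanish there and can be cancelled.\<close>

lemma points_ideal_saturated: "saturated_homogeneous_ideal n (points_ideal n A)"
  unfolding saturated_homogeneous_ideal_def
proof (intro conjI ballI allI impI)
  interpret H: comm_ring_hom "cone_eval (A a)" for a by (rule cone_eval_hom)
  show "ideal (points_ideal n A) (poly_ring {..n})"
  proof (rule idealI[OF ring_poly_ring])
    interpret R: ring "poly_ring {..n} :: (nat, 'k) mpoly ring" by (rule ring_poly_ring)
    show "subgroup (points_ideal n A) (add_monoid (poly_ring {..n}))"
    proof (rule R.add.subgroupI, goal_cases)
      case 2
      show ?case by (auto simp: points_ideal_def intro!: exI[of _ 0])
    next
      case (3 p)
      then have "\<ominus>\<^bsub>poly_ring {..n}\<^esub> p = - p"
        by (intro R.minus_equality) (auto simp: points_ideal_def)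
      moreover have "cone_eval (A a) (- p) = - cone_eval (A a) p" for a
        using H.hom_add[of a p "- p"] by (simp add: eq_neg_iff_add_eq_0 add.commute)
      ultimately show ?case using 3 by (auto simp: points_ideal_def a_inv_def)
    next
      case (4 p q)
      then show ?case using pvars_add[of p q]
        by (auto simp: points_ideal_def H.hom_add)
    qed (auto simp: points_ideal_def)
  next
    fix p q :: "(nat, 'k) mpoly" assume "p \<in> points_ideal n A" "q \<in> carrier (poly_ring {..n})"
    then show "q \<otimes>\<^bsub>poly_ring {..n}\<^esub> p \<in> points_ideal n A" "p \<otimes>\<^bsub>poly_ring {..n}\<^esub> q \<in> points_ideal n A"
      using pvars_mult[of p q] pvars_mult[of q p]
      by (auto simp: points_ideal_def H.hom_mult)
  qed
next
  fix p t assume p: "p \<in> points_ideal n A"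
  have "Poly_Mapping.keys (pcomponent t p) \<subseteq> Poly_Mapping.keys p"
    unfolding pcomponent_def using keys_sum by (fastforce split: if_splits)
  with p have "pvars (pcomponent t p) \<subseteq> {..n}" by (auto simp: points_ideal_def pvars_def)
  with p show "pcomponent t p \<in> points_ideal n A"
    by (auto simp: points_ideal_def cone_eval_pcomponent)
next
  fix p :: "(nat, 'k) mpoly" assume p: "p \<in> carrier (poly_ring {..n})" "\<exists>k. \<forall>q\<in>forms {..n} k. q * p \<in> points_ideal n A"
  then obtain k where k: "\<And>q. q \<in> forms {..n} k \<Longrightarrow> q * p \<in> points_ideal n A" by blast
  have "cone_eval (A a) p = 0" if a: "a \<le> n" for a
  proof -
    interpret comm_ring_hom "cone_eval (A a)" by (rule cone_eval_hom)
    have "dual_form a ^ k * p \<in> points_ideal n A" using forms_power[OF dual_form_forms, of a k] k by simp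
    then have "cone_eval (A a) (dual_form a) ^ k * cone_eval (A a) p = 0"
      using a by (auto simp: points_ideal_def hom_mult hom_power)
    then show ?thesis using a by (simp add: cone_eval_dual_form)
  qed
  with p(1) show "p \<in> points_ideal n A" by (auto simp: points_ideal_def)
qed

text \<open>In degree \<open>t > 0\<close> the powers \<open>L\<^sub>b\<^sup>t\<close> of the dual forms take the value \<open>1\<close> at one point and vanish at
  the others, so they complete a basis of the degree \<open>t\<close> part of the ideal to a basis of all forms. For
  \<open>t = 0\<close> all these powers are \<open>1\<close>.\<close>

lemma hilbert_function_points_ideal:
  assumes t: "t > 0"
  shows "hilbert_function n (points_ideal n A) t = n + 1"
proof -
  let ?I = "points_ideal n A \<inter> forms {..n} t"
  let ?S = "(\<lambda>b. dual_form b ^ t) ` {..n}"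
  interpret H: comm_ring_hom "cone_eval (A a)" for a by (rule cone_eval_hom)
  have Lt: "dual_form b ^ t \<in> forms {..n} t" for b using forms_power[OF dual_form_forms, of b t] by simp
  have PC: "cone_eval (A a) (PConst c) = [:c:]" for a c
    by (simp add: PConst_def cone_eval_single monom_0)
  obtain X where X: "X \<subseteq> ?I" "poly_vs.independent X" "?I \<subseteq> poly_vs.span X" "card X = poly_vs.dim ?I"
    by (rule poly_vs.basis_exists)
  have finX: "finite X"
  proof -
    have "X \<subseteq> poly_vs.span (PMon ` monomials {..n} t)"
      using X(1) forms_subset_span[of "{..n}" t] by blast
    then show ?thesis
      using poly_vs.independent_span_bound[OF _ X(2)] finite_monomials[of "{..n}" t] by blast
  qed
  have inj: "inj_on (\<lambda>b. dual_form b ^ t) {..n}"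
  proof (rule inj_onI)
    fix a b assume ab: "a \<in> {..n}" "b \<in> {..n}" "dual_form a ^ t = dual_form b ^ t"
    then have "cone_eval (A a) (dual_form a ^ t) = cone_eval (A a) (dual_form b ^ t)" by simp
    then show "a = b" using ab(1,2) t by (auto simp: cone_eval_dual_form_power split: if_splits)
  qed
  have disj: "X \<inter> ?S = {}"
  proof -
    have "dual_form b ^ t \<notin> X" if "b \<le> n" for b
    proof
      assume "dual_form b ^ t \<in> X"
      then have "cone_eval (A b) (dual_form b ^ t) = 0" using X(1) that by (auto simp: points_ideal_def)
      then show False using that t by (simp add: cone_eval_dual_form_power)
    qed
    then show ?thesis by auto
  qed
  have indep: "poly_vs.independent (X \<union> ?S)"
  proof (rule poly_vs.independent_if_scalars_zero)
    show "finite (X \<union> ?S)" using finX by simp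
  next
    fix f v assume 0: "(\<Sum>v\<in>X \<union> ?S. PConst (f v) * v) = 0" and v: "v \<in> X \<union> ?S"
    have eq: "(\<Sum>v\<in>X. PConst (f v) * v) + (\<Sum>b\<le>n. PConst (f (dual_form b ^ t)) * dual_form b ^ t) = 0"
      using 0 disj finX by (simp add: sum.union_disjoint sum.reindex[OF inj])
    have fS: "f (dual_form a ^ t) = 0" if a: "a \<le> n" for a
    proof -
      have "cone_eval (A a) (\<Sum>v\<in>X. PConst (f v) * v) = 0"
        using X(1) a by (auto simp: H.hom_sum H.hom_mult points_ideal_def intro!: sum.neutral)
      then have "(\<Sum>b\<le>n. [:f (dual_form b ^ t):] * monom (if a = b then 1 else 0) t) = 0"
        using arg_cong[OF eq, of "cone_eval (A a)"] a t
        by (simp add: H.hom_add H.hom_sum H.hom_mult PC cone_eval_dual_form_power)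
      also have "(\<Sum>b\<le>n. [:f (dual_form b ^ t):] * monom (if a = b then 1 else 0) t) =
          (\<Sum>b\<le>n. if a = b then [:f (dual_form a ^ t):] * monom 1 t else 0)"
        by (intro sum.cong) auto
      also have "\<dots> = monom (f (dual_form a ^ t)) t" using a by (simp add: smult_monom)
      finally show ?thesis by simp
    qed
    have "(\<Sum>v\<in>X. PConst (f v) * v) = 0"
      using eq fS by (simp add: PConst_def)
    then have "\<forall>v\<in>X. f v = 0"
      using poly_vs.independentD[OF X(2) finX] by blast
    then show "f v = 0" using v fS by auto
  qed
  have span: "forms {..n} t \<subseteq> poly_vs.span (X \<union> ?S)"
  proof
    fix p :: "(nat, 'k) mpoly" assume p: "p \<in> forms {..n} t"
    define c where "c a = coeff (cone_eval (A a) p) t" for a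
    define s where "s = (\<Sum>b\<le>n. PConst (c b) * dual_form b ^ t)"
    have s: "s \<in> poly_vs.span (X \<union> ?S)"
      unfolding s_def by (intro poly_vs.span_sum poly_vs.span_scale poly_vs.span_base) auto
    have sf: "s \<in> forms {..n} t"
      unfolding s_def by (intro poly_vs.subspace_sum[OF forms_subspace] poly_vs.subspace_scale[OF forms_subspace] Lt)
    then have pf: "p - s \<in> forms {..n} t" by (intro poly_vs.subspace_diff[OF forms_subspace] p)
    have "cone_eval (A a) s = cone_eval (A a) p" if a: "a \<le> n" for a
    proof -
      have "cone_eval (A a) s = (\<Sum>b\<le>n. if a = b then monom (c a) t else 0)"
        unfolding s_def H.hom_sum H.hom_mult PC using a t
        by (intro sum.cong) (auto simp: cone_eval_dual_form_power smult_monom)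
      also have "\<dots> = cone_eval (A a) p" using a cone_eval_forms[OF p, of "A a"] by (simp add: c_def)
      finally show ?thesis .
    qed
    moreover have "cone_eval (A a) (p - s) = cone_eval (A a) p - cone_eval (A a) s" for a
      using H.hom_add[of a "p - s" s] by simp
    ultimately have "p - s \<in> ?I"
      using pf forms_imp_carrier[OF pf] by (auto simp: points_ideal_def)
    then have "p - s \<in> poly_vs.span (X \<union> ?S)"
      using X(3) poly_vs.span_mono[of X "X \<union> ?S"] by blast
    from poly_vs.span_add[OF this s] show "p \<in> poly_vs.span (X \<union> ?S)" by simp
  qed
  have "X \<union> ?S \<subseteq> forms {..n} t" using X(1) Lt by auto
  from poly_vs.basis_card_eq_dim[OF this span indep]
  have "poly_vs.dim (forms {..n} t :: (nat, 'k) mpoly set) = card (X \<union> ?S)" by simp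
  also have "\<dots> = card X + (n + 1)"
    using finX disj by (simp add: card_Un_disjoint card_image[OF inj])
  finally show ?thesis by (simp add: hilbert_function_def X(4))
qed

lemma zero_dim_points_ideal: "zero_dim_scheme n (points_ideal n A)"
  and scheme_length_points_ideal: "scheme_length n (points_ideal n A) = n + 1"
proof -
  have ev: "eventually (\<lambda>t. hilbert_function n (points_ideal n A) t = n + 1) sequentially"
    using eventually_gt_at_top[of 0] by eventually_elim (rule hilbert_function_points_ideal)
  then show "zero_dim_scheme n (points_ideal n A)"
    unfolding zero_dim_scheme_def using points_ideal_saturated by (auto intro!: exI[of _ "n + 1"])
  show "scheme_length n (points_ideal n A) = n + 1"
    unfolding scheme_length_def
  proof (rule the_equality[where P = "\<lambda>l. eventually (\<lambda>t. hilbert_function n (points_ideal n A) t = l) sequentially", OF ev])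
    fix l assume "eventually (\<lambda>t. hilbert_function n (points_ideal n A) t = l) sequentially"
    with ev have "eventually (\<lambda>t::nat. l = n + 1) sequentially"
      by eventually_elim simp
    then show "l = n + 1" by simp
  qed
qed

text \<open>The hypothesis says that \<open>F\<close>, as a functional on forms of degree \<open>d\<close>, is a combination of
  evaluations at the points; a functional of this kind kills the ideal of the points.\<close>

lemma cactus_rank_le:
  assumes F: "F \<in> forms {..n} d"
    and dec: "\<And>m. m \<in> monomials {..n} d \<Longrightarrow> Poly_Mapping.lookup F m = (\<Sum>a\<le>n. c a * monval (A a) m)"
  shows "cactus_rank n F \<le> n + 1"
proof -
  interpret H: comm_ring_hom "cone_eval (A a)" for a by (rule cone_eval_hom)
  have ev: "dp_fun F g = (\<Sum>a\<le>n. c a * coeff (cone_eval (A a) g) d)" if g: "pvars g \<subseteq> {..n}" for g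
  proof -
    let ?M = "Poly_Mapping.keys g"
    have "dp_fun F g = (\<Sum>m\<in>?M. Poly_Mapping.lookup F m * Poly_Mapping.lookup g m)"
    proof -
      have "dp_fun F g = (\<Sum>m\<in>Poly_Mapping.keys F \<union> ?M. Poly_Mapping.lookup F m * Poly_Mapping.lookup g m)"
        unfolding dp_fun_def by (intro sum.mono_neutral_left) (auto simp: in_keys_iff)
      also have "\<dots> = (\<Sum>m\<in>?M. Poly_Mapping.lookup F m * Poly_Mapping.lookup g m)"
        by (intro sum.mono_neutral_right) (auto simp: in_keys_iff)
      finally show ?thesis .
    qed
    also have "\<dots> = (\<Sum>m\<in>?M. \<Sum>a\<le>n. c a * (if mdeg m = d then Poly_Mapping.lookup g m * monval (A a) m else 0))"
    proof (intro sum.cong refl)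
      fix m assume m: "m \<in> ?M"
      then have V: "Poly_Mapping.keys m \<subseteq> {..n}" using g by (auto simp: pvars_def)
      show "Poly_Mapping.lookup F m * Poly_Mapping.lookup g m =
        (\<Sum>a\<le>n. c a * (if mdeg m = d then Poly_Mapping.lookup g m * monval (A a) m else 0))"
      proof (cases "mdeg m = d")
        case True
        then show ?thesis using V by (simp add: dec monomials_def sum_distrib_left mult_ac)
      next
        case False
        then have "m \<notin> Poly_Mapping.keys F" using F by (auto simp: forms_def monomials_def)
        then show ?thesis using False by (simp add: in_keys_iff)
      qed
    qed
    also have "\<dots> = (\<Sum>a\<le>n. c a * coeff (cone_eval (A a) g) d)"
      by (subst sum.swap) (simp add: cone_eval_expand coeff_sum sum_distrib_left)
    finally show ?thesis .
  qed
  have "apolar n (points_ideal n A) F"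
    unfolding apolar_def Ann_def contract_def
  proof safe
    fix p assume p: "p \<in> points_ideal n A"
    then show "p \<in> carrier (poly_ring {..n})" by (auto simp: points_ideal_def)
    fix q :: "(nat, 'k) mpoly" assume "q \<in> carrier (poly_ring {..n})"
    then have "pvars (p * q) \<subseteq> {..n}" using p pvars_mult[of p q] by (auto simp: points_ideal_def)
    then show "dp_fun F (p * q) = 0"
      using p by (simp add: ev points_ideal_def H.hom_mult)
  qed
  then show ?thesis
    unfolding cactus_rank_def
    by (intro Least_le exI[of _ "points_ideal n A"]) (simp add: zero_dim_points_ideal scheme_length_points_ideal)
qed

end

text \<open>In degrees \<open>0\<close> and \<open>1\<close> the coordinate points suffice.\<close>

lemma cactus_rank_le_of_degree_le_2:
  fixes F :: "(nat, 'k::field) mpoly"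
  assumes F: "F \<in> forms {..n} d" and d: "d \<le> 2" and char: "(2::'k) \<noteq> 0"
  shows "cactus_rank n F \<le> n + 1"
proof (cases "d = 2")
  case True
  define Q where "Q i j = Poly_Mapping.lookup F (Poly_Mapping.single i 1 + Poly_Mapping.single j 1)" for i j
  have "\<exists>A B c. (\<forall>i\<in>{..n}. \<forall>j\<in>{..n}. Q i j = (\<Sum>k\<in>{..n}. c k * A k i * A k j)) \<and>
    (\<forall>a\<in>{..n}. \<forall>b\<in>{..n}. (\<Sum>j\<in>{..n}. A a j * B b j) = (if a = b then 1 else 0))"
    by (rule symmetric_form_diagonalization[OF _ char]) (auto simp: Q_def add.commute)
  then obtain A B c where
    Q: "\<forall>i\<in>{..n}. \<forall>j\<in>{..n}. Q i j = (\<Sum>k\<in>{..n}. c k * A k i * A k j)" and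
    dual: "\<forall>a\<in>{..n}. \<forall>b\<in>{..n}. (\<Sum>j\<in>{..n}. A a j * B b j) = (if a = b then 1 else 0)"
    by (elim exE conjE)
  interpret dual_points n A B by unfold_locales (use dual in auto)
  show ?thesis
  proof (rule cactus_rank_le[OF F])
    fix m assume m: "m \<in> monomials {..n} d"
    with True have "mdeg m = Suc 1" by (simp add: monomials_def)
    then obtain i m' where i: "i \<in> Poly_Mapping.keys m" "m = Poly_Mapping.single i 1 + m'" "mdeg m' = 1"
      "Poly_Mapping.keys m' \<subseteq> Poly_Mapping.keys m" by (rule mdeg_Suc_obtain)
    from i(3) have "mdeg m' = Suc 0" by simp
    then obtain j where j: "j \<in> Poly_Mapping.keys m'" "m' = Poly_Mapping.single j 1"
      by (rule mdeg_Suc_obtain) auto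
    have "i \<le> n" "j \<le> n" using i j m by (auto simp: monomials_def)
    then show "Poly_Mapping.lookup F m = (\<Sum>a\<le>n. c a * monval (A a) m)"
      using Q by (simp add: i(2) j(2) Q_def monval_add mult.assoc)
  qed
next
  case False
  define E where "E a j = (if a = j then 1 else (0::'k))" for a j :: nat
  interpret dual_points n E E
    by unfold_locales (auto simp: E_def if_distrib[of "\<lambda>x. x * _"] cong: if_cong)
  show ?thesis
  proof (cases "d = 1")
    case True
    show ?thesis
    proof (rule cactus_rank_le[OF F])
      fix m assume m: "m \<in> monomials {..n} d"
      with True have "mdeg m = Suc 0" by (simp add: monomials_def)
      then obtain j where j: "j \<in> Poly_Mapping.keys m" "m = Poly_Mapping.single j 1"
        by (rule mdeg_Suc_obtain) auto
      with m have "j \<le> n" by (auto simp: monomials_def)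
      then show "Poly_Mapping.lookup F m =
          (\<Sum>a\<le>n. Poly_Mapping.lookup F (Poly_Mapping.single a 1) * monval (E a) m)"
        by (simp add: j(2) E_def if_distrib[of "\<lambda>x. _ * x"] cong: if_cong)
    qed
  next
    case d: False
    show ?thesis
    proof (rule cactus_rank_le[OF F])
      fix m assume m: "m \<in> monomials {..n} d"
      have "d = 0" using d False \<open>d \<le> 2\<close> by linarith
      with m have "m = 0" by (simp add: monomials_def)
      then show "Poly_Mapping.lookup F m = (\<Sum>a\<le>n. (if a = 0 then Poly_Mapping.lookup F 0 else 0) * monval (E a) m)"
        by simp
    qed
  qed
qed

section \<open>Renaming the variables of rational functions\<close>

lemma psubst_PConst [simp]: "psubst \<sigma> (PConst c) = PConst c"
  unfolding psubst_eq_peval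
  by (simp add: PConst_def comm_ring_hom.peval_single[OF PConst_hom])

lemma psubst_PVar [simp]:
  fixes \<sigma> :: "'v \<Rightarrow> ('w, 'k::comm_ring_1) mpoly"
  shows "psubst \<sigma> (PVar v) = \<sigma> v"
proof -
  interpret comm_ring_hom "PConst :: 'k \<Rightarrow> ('w, 'k) mpoly" by (rule PConst_hom)
  show ?thesis by (simp add: psubst_eq_peval PVar_def PMon_def peval_single)
qed

lemma pvars_rename:
  fixes \<psi> :: "'v \<Rightarrow> 'w"
  shows "pvars (psubst (\<lambda>v. PVar (\<psi> v)) p) \<subseteq> \<psi> ` pvars (p :: ('v, 'k::comm_ring_1) mpoly)"
proof -
  let ?x = "\<lambda>v. PVar (\<psi> v) :: ('w, 'k) mpoly"
  have x: "pvars (?x v) \<subseteq> {\<psi> v}" for v by (simp add: PVar_def)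
  have "pvars (psubst ?x p) \<subseteq> (\<Union>m\<in>Poly_Mapping.keys p.
      pvars (PConst (Poly_Mapping.lookup p m) * (\<Prod>v\<in>Poly_Mapping.keys m. ?x v ^ Poly_Mapping.lookup m v)))"
    unfolding psubst_def by (rule pvars_sum)
  also have "\<dots> \<subseteq> (\<Union>m\<in>Poly_Mapping.keys p. \<Union>v\<in>Poly_Mapping.keys m. {\<psi> v})"
  proof (rule UN_mono[OF order_refl])
    fix m
    have "pvars (PConst (Poly_Mapping.lookup p m) * (\<Prod>v\<in>Poly_Mapping.keys m. ?x v ^ Poly_Mapping.lookup m v))
      \<subseteq> pvars (\<Prod>v\<in>Poly_Mapping.keys m. ?x v ^ Poly_Mapping.lookup m v)"
      using pvars_mult[of "PConst (Poly_Mapping.lookup p m)"] by fastforce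
    also have "\<dots> \<subseteq> (\<Union>v\<in>Poly_Mapping.keys m. pvars (?x v ^ Poly_Mapping.lookup m v))"
      by (rule pvars_prod)
    also have "\<dots> \<subseteq> (\<Union>v\<in>Poly_Mapping.keys m. {\<psi> v})"
      by (intro UN_mono order_refl order_trans[OF pvars_power x])
    finally show "pvars (PConst (Poly_Mapping.lookup p m) * (\<Prod>v\<in>Poly_Mapping.keys m. ?x v ^ Poly_Mapping.lookup m v))
      \<subseteq> (\<Union>v\<in>Poly_Mapping.keys m. {\<psi> v})" .
  qed
  also have "\<dots> = \<psi> ` pvars p" by (auto simp: pvars_def)
  finally show ?thesis .
qed

lemma rename_rename_inverse:
  fixes p :: "('v, 'k::comm_ring_1) mpoly"
  assumes "\<And>v. \<phi> (\<psi> v) = v"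
  shows "psubst (\<lambda>v. PVar (\<phi> v)) (psubst (\<lambda>v. PVar (\<psi> v)) p) = p"
proof (rule mpoly_hom_eqI[where f = "\<lambda>p. psubst (\<lambda>v. PVar (\<phi> v)) (psubst (\<lambda>v. PVar (\<psi> v)) p)"])
  interpret a: comm_ring_hom "psubst (\<lambda>v. PVar (\<phi> v)) :: _ \<Rightarrow> ('v, 'k) mpoly" by (rule psubst_hom)
  interpret b: comm_ring_hom "psubst (\<lambda>v. PVar (\<psi> v)) :: ('v, 'k) mpoly \<Rightarrow> _" by (rule psubst_hom)
  show "comm_ring_hom (\<lambda>p. psubst (\<lambda>v. PVar (\<phi> v)) (psubst (\<lambda>v. PVar (\<psi> v)) p :: (_, 'k) mpoly))"
    by unfold_locales (simp_all add: a.hom_add b.hom_add a.hom_mult b.hom_mult)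
qed (auto simp: assms intro: id_hom)

text \<open>Independence of the representation: equal fractions have equal cross products, and
  substitution preserves these.\<close>

lemma rrename_Fract:
  fixes a b :: "('v::linorder, 'k::field) mpoly" and \<psi> :: "'v \<Rightarrow> 'w::linorder"
  assumes nz: "psubst (\<lambda>v. PVar (\<psi> v)) b \<noteq> 0"
  shows "rrename \<psi> (Fract a b) =
    Fract (psubst (\<lambda>v. PVar (\<psi> v)) a) (psubst (\<lambda>v. PVar (\<psi> v)) b)"
proof -
  let ?s = "psubst (\<lambda>v. PVar (\<psi> v)) :: ('v, 'k) mpoly \<Rightarrow> ('w, 'k) mpoly"
  interpret comm_ring_hom ?s by (rule psubst_hom)
  show ?thesis
    unfolding rrename_def
  proof (rule the_equality)
    show "\<exists>a' b'. Fract a b = Fract a' b' \<and> ?s b' \<noteq> 0 \<and> Fract (?s a) (?s b) = Fract (?s a') (?s b')"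
      using nz by blast
    fix q' assume "\<exists>a' b'. Fract a b = Fract a' b' \<and> ?s b' \<noteq> 0 \<and> q' = Fract (?s a') (?s b')"
    then obtain a' b' where eq: "Fract a b = Fract a' b'" and b': "?s b' \<noteq> 0" and q': "q' = Fract (?s a') (?s b')"
      by blast
    from nz b' have "b \<noteq> 0" "b' \<noteq> 0" by auto
    with eq have "a * b' = a' * b" by (simp add: eq_fract)
    then have "?s a * ?s b' = ?s a' * ?s b" by (metis hom_mult)
    with nz b' show "q' = Fract (?s a) (?s b)" by (simp add: q' eq_fract)
  qed
qed

text \<open>The type argument fixes the coefficient field, which the two inverse maps do not determine.\<close>

locale renaming =
  fixes \<psi> :: "'v::linorder \<Rightarrow> 'w::linorder" and \<phi> :: "'w \<Rightarrow> 'v" and k_type :: "'k::field itself"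
  assumes left_inverse: "\<And>v. \<phi> (\<psi> v) = v" and right_inverse: "\<And>w. \<psi> (\<phi> w) = w"
begin

abbreviation ren :: "('v, 'k) mpoly \<Rightarrow> ('w, 'k) mpoly" where
  "ren \<equiv> psubst (\<lambda>v. PVar (\<psi> v))"

abbreviation rr :: "('v, 'k) ratfun \<Rightarrow> ('w, 'k) ratfun" where
  "rr \<equiv> rrename \<psi>"

sublocale ren: comm_ring_hom ren by (rule psubst_hom)

lemma ren_eq_0_iff [simp]: "ren p = 0 \<longleftrightarrow> p = 0"
proof
  assume "ren p = 0"
  moreover have "psubst (\<lambda>v. PVar (\<phi> v)) (ren p) = p"
    by (rule rename_rename_inverse) (rule left_inverse)
  ultimately show "p = 0" by (simp add: psubst_def)
qed simp

lemma rr_Fract [simp]: "b \<noteq> 0 \<Longrightarrow> rr (Fract a b) = Fract (ren a) (ren b)"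
  by (rule rrename_Fract) simp

sublocale rr: comm_ring_hom rr
proof
  fix x y :: "('v, 'k) ratfun"
  obtain a b c e where "x = Fract a b" "b \<noteq> 0" "y = Fract c e" "e \<noteq> 0"
    by (metis Fract_cases)
  then show "rr (x + y) = rr x + rr y" "rr (x * y) = rr x * rr y"
    by (simp_all add: ren.hom_add ren.hom_mult)
qed (simp_all add: Zero_fract_def One_fract_def)

lemma rr_eq_0_iff: "rr x = 0 \<longleftrightarrow> x = 0"
proof
  assume "rr x = 0"
  moreover have "x \<noteq> 0 \<Longrightarrow> rr x * rr (inverse x) = 1"
    by (simp flip: rr.hom_mult)
  ultimately show "x = 0" by force
qed simp

lemma rvars_rr_subset: "rvars (rr q) \<subseteq> \<psi> ` rvars q"
proof
  fix w assume w: "w \<in> rvars (rr q)"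
  have "\<phi> w \<in> rvars q"
  proof (rule ccontr)
    assume "\<phi> w \<notin> rvars q"
    then obtain a b where ab: "b \<noteq> 0" "\<phi> w \<notin> pvars a" "\<phi> w \<notin> pvars b" "q = Fract a b"
      unfolding rvars_def by blast
    have "w \<notin> pvars (ren p)" if "\<phi> w \<notin> pvars p" for p
      using pvars_rename[of \<psi> p] that left_inverse by auto
    then have "\<exists>a' b'. b' \<noteq> 0 \<and> w \<notin> pvars a' \<and> w \<notin> pvars b' \<and> rr q = Fract a' b'"
      using ab by (intro exI[of _ "ren a"] exI[of _ "ren b"]) auto
    with w show False unfolding rvars_def by blast
  qed
  then have "\<psi> (\<phi> w) \<in> \<psi> ` rvars q" by (rule imageI)
  then show "w \<in> \<psi> ` rvars q" by (simp add: right_inverse)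
qed

end

text \<open>A fraction avoiding \<open>v\<close> is renamed to one avoiding \<open>\<psi> v\<close>; the converse is the same argument for the
  inverse renaming. Since the variables of a fraction are defined through all its representations,
  which may involve arbitrary further variables, a global inverse is convenient here.\<close>

lemma rvars_rrename:
  fixes q :: "('v::linorder, 'k::field) ratfun" and \<psi> :: "'v \<Rightarrow> 'w::linorder"
  assumes l: "\<And>v. \<phi> (\<psi> v) = v" and r: "\<And>w. \<psi> (\<phi> w) = w"
  shows "rvars (rrename \<psi> q) = \<psi> ` rvars q"
proof
  interpret f: renaming \<psi> \<phi> "TYPE('k)" by unfold_locales (simp_all add: l r)
  interpret g: renaming \<phi> \<psi> "TYPE('k)" by unfold_locales (simp_all add: l r)
  show "rvars (rrename \<psi> q) \<subseteq> \<psi> ` rvars q" by (rule f.rvars_rr_subset)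
  obtain a b where q: "q = Fract a b" "b \<noteq> 0" by (metis Fract_cases)
  moreover have "psubst (\<lambda>v. PVar (\<phi> v)) (psubst (\<lambda>v. PVar (\<psi> v)) p) = p" for p :: "('v, 'k) mpoly"
    by (rule rename_rename_inverse) (rule l)
  ultimately have "rrename \<phi> (rrename \<psi> q) = q" by simp
  with g.rvars_rr_subset[of "rrename \<psi> q"] have "rvars q \<subseteq> \<phi> ` rvars (rrename \<psi> q)" by simp
  then show "\<psi> ` rvars q \<subseteq> rvars (rrename \<psi> q)" using r by fastforce
qed

lemma mat_rvars_map_rrename:
  fixes M :: "('v::linorder, 'k::field) ratfun mat" and \<psi> :: "'v \<Rightarrow> 'w::linorder"
  assumes "\<And>v. \<phi> (\<psi> v) = v" "\<And>w. \<psi> (\<phi> w) = w"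
  shows "mat_rvars (map_mat (rrename \<psi>) M) = \<psi> ` mat_rvars M"
  unfolding mat_rvars_def elements_mat_map by (simp add: rvars_rrename[OF assms] image_UN)

text \<open>Inside the finite set \<open>V \<union> f ` V\<close> the complements of \<open>V\<close> and of \<open>f ` V\<close> have the same size, so
  they can be matched; outside it the identity does.\<close>

lemma extend_inj_on_to_bij:
  fixes f :: "'a \<Rightarrow> 'a"
  assumes fin: "finite V" and inj: "inj_on f V"
  shows "\<exists>g. bij g \<and> (\<forall>v\<in>V. g v = f v)"
proof -
  let ?U = "V \<union> f ` V"
  have "card (?U - V) = card (?U - f ` V)"
    using fin card_image[OF inj] by (simp add: card_Diff_subset)
  then obtain h where h: "bij_betw h (?U - V) (?U - f ` V)"
    using fin finite_same_card_bij[of "?U - V" "?U - f ` V"] by auto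
  let ?g = "\<lambda>x. if x \<in> V then f x else if x \<in> ?U then h x else x"
  have "bij_betw ?g V (f ` V)" using inj by (auto simp: bij_betw_def inj_on_def)
  moreover have "bij_betw ?g (?U - V) (?U - f ` V)"
    using h by (subst bij_betw_cong[of _ _ h]) auto
  ultimately have "bij_betw ?g (V \<union> (?U - V)) (f ` V \<union> (?U - f ` V))"
    by (rule bij_betw_combine) auto
  then have "bij_betw ?g ?U ?U" by (simp add: Un_absorb1 Un_commute)
  moreover have "bij_betw ?g (- ?U) (- ?U)"
    by (subst bij_betw_cong[of _ _ id]) auto
  ultimately have "bij_betw ?g (?U \<union> - ?U) (?U \<union> - ?U)"
    by (rule bij_betw_combine) auto
  then have "bij ?g" by (simp only: Compl_partition)
  then show ?thesis by (intro exI[of _ ?g]) simp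
qed

section \<open>Nonsingularity of the Hankel matrix\<close>

lemma inverse_solves:
  fixes T S :: "'a::field mat"
  assumes T: "T \<in> carrier_mat r r" and S: "S \<in> carrier_mat r r" and det: "det T \<noteq> 0"
  shows "M \<in> carrier_mat r r \<and> S = transpose_mat M * T \<longleftrightarrow>
    M = transpose_mat (S * the (mat_inverse T))"
proof -
  have "mat_inverse T \<noteq> None"
    using mat_inverse(1)[OF T, of "()"] det_non_zero_imp_unit[OF T det, of "()"] by blast
  then obtain B where B: "mat_inverse T = Some B" by blast
  with mat_inverse(2)[OF T] have inv: "T * B = 1\<^sub>m r" "B * T = 1\<^sub>m r" "B \<in> carrier_mat r r" by auto
  show ?thesis
  proof
    assume M: "M \<in> carrier_mat r r \<and> S = transpose_mat M * T"
    then have "S * B = transpose_mat M * (T * B)"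
      using T inv(3) by (simp add: assoc_mult_mat[of _ r r _ r _ r])
    moreover have "transpose_mat M * 1\<^sub>m r = transpose_mat M"
      by (rule right_mult_one_mat[of _ r r]) (use M in simp)
    ultimately show "M = transpose_mat (S * the (mat_inverse T))" using inv B by simp
  next
    assume M: "M = transpose_mat (S * the (mat_inverse T))"
    then have "transpose_mat M * T = S * (B * T)"
      using T S inv(3) B by (simp add: assoc_mult_mat[of _ r r _ r _ r])
    then show "M \<in> carrier_mat r r \<and> S = transpose_mat M * T"
      using M S inv B by simp
  qed
qed

text \<open>A kernel vector of the Gram matrix gives a combination \<open>p\<close> of the basis with \<open>\<Lambda>(p b\<^sub>j) = 0\<close> for
  all \<open>j\<close>. The \<open>b\<^sub>j\<close> span modulo the annihilator, so \<open>p\<close> lies in the annihilator, and the \<open>b\<^sub>j\<close> are independent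
  modulo it.\<close>

lemma gram_det_nonzero:
  fixes \<Lambda> :: "('v, 'k::field) mpoly \<Rightarrow> 'k"
  assumes dual: "\<Lambda> \<in> poly_dual V" and basis: "monomial_basis V (Ann V \<Lambda>) r b"
  shows "det (mat r r (\<lambda>(j, k). \<Lambda> (PMon (b j + b k)))) \<noteq> 0"
proof
  let ?M = "mat r r (\<lambda>(j, k). \<Lambda> (PMon (b j + b k)))"
  assume "det ?M = 0"
  then obtain v where v: "v \<in> carrier_vec r" "v \<noteq> 0\<^sub>v r" "?M *\<^sub>v v = 0\<^sub>v r"
    using det_0_iff_vec_prod_zero_field[of ?M r] by auto
  have add: "\<Lambda> (p + q) = \<Lambda> p + \<Lambda> q" if "pvars p \<subseteq> V" "pvars q \<subseteq> V" for p q
    using dual that by (auto simp: poly_dual_def)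
  have scale: "\<Lambda> (PConst c * p) = c * \<Lambda> p" if "pvars p \<subseteq> V" for c p
    using dual that by (auto simp: poly_dual_def)
  have zero: "\<Lambda> 0 = 0" using scale[of 0 0] by simp
  have lin: "\<Lambda> (\<Sum>j<m. PConst (c j) * q j) = (\<Sum>j<m. c j * \<Lambda> (q j)) \<and> pvars (\<Sum>j<m. PConst (c j) * q j) \<subseteq> V"
    if qV: "\<forall>j<m. pvars (q j) \<subseteq> V" for m :: nat and c q
    using qV
  proof (induction m)
    case (Suc m)
    have "pvars (PConst (c m) * q m) \<subseteq> V" using Suc.prems pvars_mult[of "PConst (c m)" "q m"] by auto
    then show ?case using Suc pvars_add[of "\<Sum>j<m. PConst (c j) * q j" "PConst (c m) * q m"]
      by (auto simp: add scale)
  qed (simp add: zero)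
  have keys: "Poly_Mapping.keys (b j) \<subseteq> V" if "j < r" for j
    using basis that by (auto simp: monomial_basis_def)
  have bb: "pvars (PMon (b j + b k) :: ('v, 'k) mpoly) \<subseteq> V" if "j < r" "k < r" for j k
    using keys_add[of "b j" "b k"] keys[OF that(1)] keys[OF that(2)] by auto
  define p where "p = (\<Sum>k<r. PConst (v $ k) * PMon (b k))"
  have pV: "pvars p \<subseteq> V" unfolding p_def using lin[of r "\<lambda>k. PMon (b k)"] keys by simp
  have pb: "\<Lambda> (PMon (b j) * p) = 0" if j: "j < r" for j
  proof -
    have "PMon (b j) * p = (\<Sum>k<r. PConst (v $ k) * PMon (b j + b k))"
      by (simp add: p_def sum_distrib_left PMon_def PConst_def mult_single)
    then have "\<Lambda> (PMon (b j) * p) = (\<Sum>k<r. v $ k * \<Lambda> (PMon (b j + b k)))"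
      using lin[of r "\<lambda>k. PMon (b j + b k)"] bb[OF j] by simp
    also have "\<dots> = (?M *\<^sub>v v) $ j"
      using j v(1) by (simp add: scalar_prod_def mult.commute lessThan_atLeast0)
    finally show ?thesis using v(3) j by simp
  qed
  have "p \<in> Ann V \<Lambda>"
    unfolding Ann_def contract_def
  proof (simp add: pV, intro allI impI)
    fix q :: "('v, 'k) mpoly" assume q: "pvars q \<subseteq> V"
    then obtain c where c: "q - (\<Sum>j<r. PConst (c j) * PMon (b j)) \<in> Ann V \<Lambda>"
      using basis by (auto simp: monomial_basis_def)
    let ?s = "\<Sum>j<r. PConst (c j) * PMon (b j)"
    have bp: "pvars (PMon (b j) * p) \<subseteq> V" if "j < r" for j
      using pvars_mult[of "PMon (b j)" p] keys[OF that] pV by auto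
    have sp: "?s * p = (\<Sum>j<r. PConst (c j) * (PMon (b j) * p))"
      by (simp add: sum_distrib_right mult.assoc)
    have "\<Lambda> (?s * p) = 0" and spV: "pvars (?s * p) \<subseteq> V"
      unfolding sp using lin[of r "\<lambda>j. PMon (b j) * p" c] bp pb by auto
    moreover have "\<Lambda> ((q - ?s) * p) = 0" and "pvars ((q - ?s) * p) \<subseteq> V"
      using c pV pvars_mult[of "q - ?s" p] by (auto simp: Ann_def contract_def)
    ultimately have "\<Lambda> ((q - ?s) * p + ?s * p) = 0" by (simp add: add)
    then show "\<Lambda> (p * q) = 0" by (simp add: algebra_simps)
  qed
  then have "\<forall>j<r. v $ j = 0"
    using basis by (auto simp: monomial_basis_def p_def)
  then show False using v(1,2) by auto
qed

lemma Fract_hom: "comm_ring_hom (\<lambda>p::'a::idom. Fract p 1)"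
  by unfold_locales (simp_all add: Zero_fract_def One_fract_def)

text \<open>The determinant is a polynomial in the moment variables, so it suffices to find one
  specialization at which it does not vanish. The functional \<open>\<Lambda>\<close> itself provides one, because it
  agrees with the known moments in degree at most \<open>d\<close>.\<close>

lemma hankel_det_nonzero:
  fixes F :: "(nat, 'k::field) mpoly"
  assumes "\<Lambda> \<in> poly_dual {1..n}" and ext: "extends_dehom n d F \<Lambda>"
    and basis: "monomial_basis {1..n} (Ann {1..n} \<Lambda>) r b"
  shows "det (hankel d F r b) \<noteq> 0"
proof -
  define mp :: "nat mon \<Rightarrow> (nat mon, 'k) mpoly" where
    "mp \<alpha> = (if mdeg \<alpha> \<le> d then PConst (Poly_Mapping.lookup F (Poly_Mapping.single 0 (d - mdeg \<alpha>) + \<alpha>))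
       else PVar \<alpha>)" for \<alpha>
  define P where "P = mat r r (\<lambda>(j, k). mp (b j + b k))"
  let ?ev = "peval (\<lambda>c. c) (\<lambda>\<alpha>. \<Lambda> (PMon \<alpha>)) :: (nat mon, 'k) mpoly \<Rightarrow> 'k"
  interpret Fr: comm_ring_hom "\<lambda>p :: (nat mon, 'k) mpoly. Fract p 1" by (rule Fract_hom)
  interpret ev: comm_ring_hom ?ev by (rule comm_ring_hom.comm_ring_hom_peval[OF id_hom])
  have H: "hankel d F r b = map_mat (\<lambda>p. Fract p 1) P"
    by (rule eq_matI) (auto simp: hankel_def P_def mp_def moment_def RConst_def RVar_def)
  have "?ev (mp (b j + b k)) = \<Lambda> (PMon (b j + b k))" if "j < r" "k < r" for j k
  proof -
    have "Poly_Mapping.keys (b j) \<subseteq> {1..n}" "Poly_Mapping.keys (b k) \<subseteq> {1..n}"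
      using basis that by (auto simp: monomial_basis_def)
    with keys_add[of "b j" "b k"] have "Poly_Mapping.keys (b j + b k) \<subseteq> {1..n}" by auto
    then show ?thesis using ext
      by (auto simp: mp_def extends_dehom_def comm_ring_hom.peval_single[OF id_hom] PConst_def PVar_def PMon_def)
  qed
  then have "map_mat ?ev P = mat r r (\<lambda>(j, k). \<Lambda> (PMon (b j + b k)))"
    by (intro eq_matI) (auto simp: P_def)
  then have "?ev (det P) \<noteq> 0"
    using gram_det_nonzero[OF assms(1) basis] by (simp flip: ev.hom_det)
  then have "det P \<noteq> 0" by auto
  moreover have "det (hankel d F r b) = Fract (det P) 1" unfolding H by (rule Fr.hom_det)
  ultimately show ?thesis
    using eq_fract(1)[of 1 1 "det P" 0] by (auto simp flip: Zero_fract_def)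
qed

section \<open>The canonical bijection of variables\<close>

lemma basis_prod_add: "basis_prod b (m + m') = basis_prod b m + basis_prod b m'"
proof -
  let ?A = "Poly_Mapping.keys m \<union> Poly_Mapping.keys m'"
  have sup: "basis_prod b l = (\<Sum>j\<in>?A. \<Sum>_<Poly_Mapping.lookup l j. b j)"
    if "Poly_Mapping.keys l \<subseteq> ?A" for l
    unfolding basis_prod_def using that by (intro sum.mono_neutral_left) (auto simp: in_keys_iff)
  have split: "(\<Sum>_<(x::nat) + y. c) = (\<Sum>_<x. c) + (\<Sum>_<y. c)" for x y and c :: "nat mon"
    by (simp add: distrib_right)
  show ?thesis
    using keys_add[of m m'] by (simp add: sup lookup_add split sum.distrib distrib_right)
qed

lemma basis_prod_list: "basis_prod b (\<Sum>j\<leftarrow>js. Poly_Mapping.single j 1) = (\<Sum>j\<leftarrow>js. b j)"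
  by (induction js) (simp_all add: basis_prod_add, simp_all add: basis_prod_def)

lemma sum_list_single_in_monomials:
  "set js \<subseteq> V \<Longrightarrow> (\<Sum>j\<leftarrow>js. Poly_Mapping.single j 1) \<in> monomials V (length js)"
proof (induction js)
  case (Cons j js)
  then show ?case
    using keys_add[of "Poly_Mapping.single j 1" "\<Sum>j\<leftarrow>js. Poly_Mapping.single j (1::nat)"]
    by (auto simp: monomials_def mdeg_add)
qed (simp add: monomials_def)

lemma lookup_sym_tensor:
  assumes "m \<in> monomials {..<r} d"
  shows "Poly_Mapping.lookup (sym_tensor d F r b) m = tensor_coeff d F r b m"
proof -
  have "Poly_Mapping.lookup (sym_tensor d F r b) m =
    (\<Sum>l\<in>monomials {..<r} d. if l = m then tensor_coeff d F r b m else 0)"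
    unfolding sym_tensor_def lookup_sum by (intro sum.cong) (auto simp: lookup_single when_def)
  then show ?thesis using assms finite_monomials[of "{..<r}" d] by simp
qed

text \<open>The index of the variable that stands for all the undetermined coefficients \<open>\<lambda>\<^sub>m\<close> with \<open>m' = \<alpha>\<close>.\<close>

definition least_preimage :: "nat \<Rightarrow> nat \<Rightarrow> (nat \<Rightarrow> nat mon) \<Rightarrow> nat mon \<Rightarrow> nat mon" where
  "least_preimage d r b \<alpha> = Min {k \<in> monomials {..<r} d. basis_prod b k = \<alpha>}"

lemma basis_prod_least_preimage:
  assumes "m \<in> monomials {..<r} d"
  shows "basis_prod b (least_preimage d r b (basis_prod b m)) = basis_prod b m"
proof -
  have "least_preimage d r b (basis_prod b m) \<in> {k \<in> monomials {..<r} d. basis_prod b k = basis_prod b m}"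
    unfolding least_preimage_def using assms finite_monomials[of "{..<r}" d] by (intro Min_in) auto
  then show ?thesis by simp
qed

theorem claim1:
  fixes F :: "(nat, 'k::{alg_closed_field, field_char_0}) mpoly"
    and \<Lambda> :: "(nat, 'k) mpoly \<Rightarrow> 'k"
    and b :: "nat \<Rightarrow> nat mon"
    and n d r :: nat
  assumes "F \<in> forms {..n} d"
    and "concise n d F"
    and "cactus_rank n F = r"
    and "r > n + 1"
    and "\<Lambda> \<in> poly_dual {1..n}"
    and "extends_dehom n d F \<Lambda>"
    and "artinian_gorenstein {1..n} (Ann {1..n} \<Lambda>)"
    and "zero_dim_scheme n (projective_ideal n (Ann {1..n} \<Lambda>))"
    and "scheme_length n (projective_ideal n (Ann {1..n} \<Lambda>)) = r"
    and "apolar n (projective_ideal n (Ann {1..n} \<Lambda>)) F"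
    and "b 0 = 0"
    and "\<forall>i\<in>{1..n}. b i = Poly_Mapping.single i 1"
    and "monomial_basis {1..n} (Ann {1..n} \<Lambda>) r b"
  shows "\<exists>\<Psi>. bij_betw \<Psi>
      (\<Union>i\<in>{1..n}. mat_rvars (hankel_mult d F r b i))
      (\<Union>i\<in>{1..n}. mat_rvars (tensor_mult d F r b i)) \<and>
    (\<forall>i\<in>{1..n}. map_mat (rrename \<Psi>) (hankel_mult d F r b i) = tensor_mult d F r b i)"
proof -
  have d: "d \<ge> 3"
  proof (rule ccontr)
    assume "\<not> d \<ge> 3"
    then have "cactus_rank n F \<le> n + 1"
      by (intro cactus_rank_le_of_degree_le_2[OF assms(1)]) auto
    with assms(3,4) show False by simp
  qed
  \<comment> \<open>All exponents for which the tensor has a coefficient; every entry of the Hankel matrices belongs to one.\<close>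
  let ?V = "basis_prod b ` monomials {..<r} d"
  have "inj_on (least_preimage d r b) ?V"
    by (rule inj_on_inverseI[of _ "basis_prod b"]) (auto simp: basis_prod_least_preimage)
  then obtain \<Psi> where bij: "bij \<Psi>" and \<Psi>: "\<And>\<alpha>. \<alpha> \<in> ?V \<Longrightarrow> \<Psi> \<alpha> = least_preimage d r b \<alpha>"
    using extend_inj_on_to_bij[of ?V "least_preimage d r b"] finite_monomials[of "{..<r}" d] by blast
  obtain \<Phi> where inv: "\<Phi> (\<Psi> v) = v" "\<Psi> (\<Phi> w) = w" for v w
    using bij by (metis bij_iff)
  interpret renaming \<Psi> \<Phi> "TYPE('k)" by unfold_locales (simp_all add: inv)
  \<comment> \<open>Known coefficients are constants on both sides, which renaming fixes.\<close>
  have coeff: "multilinear_value (sym_tensor d F r b) js = rr (moment d F (\<Sum>j\<leftarrow>js. b j))"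
    if js: "set js \<subseteq> {..<r}" "length js = d" for js
  proof -
    let ?m = "\<Sum>j\<leftarrow>js. Poly_Mapping.single j (1::nat)"
    have m: "?m \<in> monomials {..<r} d" using sum_list_single_in_monomials[OF js(1)] js(2) by simp
    then have "tensor_coeff d F r b ?m = rr (moment d F (basis_prod b ?m))"
      using \<Psi>[OF imageI[OF m]]
      by (auto simp: tensor_coeff_def moment_def Let_def RConst_def RVar_def least_preimage_def)
    then show ?thesis
      unfolding multilinear_value_def lookup_sym_tensor[OF m] basis_prod_list .
  qed
  have r: "r > 0" using assms(4) by simp
  have rep: "(\<Sum>j\<leftarrow>replicate k 0. b j) = 0" for k
    by (induction k) (simp_all add: assms(11))
  let ?H = "hankel d F r b" and ?HS = "hankel_shift d F r b"
  let ?T = "tensor_mat d F r b" and ?TS = "tensor_mat_shift d F r b"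
  have T: "?T = map_mat rr ?H"
  proof (rule eq_matI)
    fix j k assume "j < dim_row (map_mat rr ?H)" "k < dim_col (map_mat rr ?H)"
    then have "j < r" "k < r" by (simp_all add: hankel_def)
    then show "?T $$ (j, k) = map_mat rr ?H $$ (j, k)"
      using d r rep by (simp add: tensor_mat_def hankel_def coeff)
  qed (simp_all add: tensor_mat_def hankel_def)
  have TS: "?TS i = map_mat rr (?HS i)" if i: "i \<in> {1..n}" for i
  proof (rule eq_matI)
    fix j k assume "j < dim_row (map_mat rr (?HS i))" "k < dim_col (map_mat rr (?HS i))"
    then have "j < r" "k < r" by (simp_all add: hankel_shift_def)
    moreover have "i < r" and bi: "b i = Poly_Mapping.single i 1" using i assms(4,12) by auto
    moreover have "length (replicate (d - 3) 0 @ [i, j, k]) = d" using d by simp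
    ultimately have "multilinear_value (sym_tensor d F r b) (replicate (d - 3) 0 @ [i, j, k]) =
        rr (moment d F (\<Sum>j\<leftarrow>replicate (d - 3) 0 @ [i, j, k]. b j))"
      using r by (intro coeff) auto
    then show "?TS i $$ (j, k) = map_mat rr (?HS i) $$ (j, k)"
      using \<open>j < r\<close> \<open>k < r\<close> rep by (simp add: tensor_mat_shift_def hankel_shift_def bi add.assoc)
  qed (simp_all add: tensor_mat_shift_def hankel_shift_def)
  have carrier: "?H \<in> carrier_mat r r" "?HS i \<in> carrier_mat r r"
    "?T \<in> carrier_mat r r" "?TS i \<in> carrier_mat r r" for i
    by (simp_all add: hankel_def hankel_shift_def tensor_mat_def tensor_mat_shift_def)
  have detH: "det ?H \<noteq> 0" by (rule hankel_det_nonzero) fact+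
  have detT: "det ?T \<noteq> 0"
    using detH by (simp add: T rr_eq_0_iff)
  have eq: "map_mat rr (hankel_mult d F r b i) = tensor_mult d F r b i" if i: "i \<in> {1..n}" for i
  proof -
    let ?M = "hankel_mult d F r b i"
    have "?M = transpose_mat (?HS i * the (mat_inverse ?H))"
      unfolding hankel_mult_def inverse_solves[OF carrier(1) carrier(2) detH] by (rule the_eq_trivial)
    from inverse_solves[OF carrier(1) carrier(2) detH, THEN iffD2, OF this]
    have M: "?M \<in> carrier_mat r r" "?HS i = transpose_mat ?M * ?H" by blast+
    have "?TS i = transpose_mat (map_mat rr ?M) * ?T"
      using arg_cong[OF M(2), of "map_mat rr"] rr.mat_hom_mult[of "transpose_mat ?M" r r ?H r] M(1) carrier(1)
      by (simp add: T TS[OF i] map_mat_transpose)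
    then show ?thesis
      unfolding tensor_mult_def
      by (intro inverse_solves[OF carrier(3) carrier(4) detT, THEN iffD1] conjI) (use M(1) in simp)
  qed
  have "(\<Union>i\<in>{1..n}. mat_rvars (tensor_mult d F r b i)) = \<Psi> ` (\<Union>i\<in>{1..n}. mat_rvars (hankel_mult d F r b i))"
    by (simp add: image_UN eq[symmetric] mat_rvars_map_rrename[OF inv])
  then have "bij_betw \<Psi> (\<Union>i\<in>{1..n}. mat_rvars (hankel_mult d F r b i))
      (\<Union>i\<in>{1..n}. mat_rvars (tensor_mult d F r b i))"
    using bij by (auto simp: bij_betw_def inj_on_def)
  with eq show ?thesis by blast
qed

end
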